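(* Let $x=\Gamma g\in X$ and suppose $\xi_g=g\infty$ is irrational, i.e. $\xi_g\notin\mathbb P^1(\mathbb F_q(t))$. Let $R\in2\mathbb Z_{\ge0}$, and let $\Phi:2\mathbb Z_{\ge0}\to\mathbb C$ satisfy $\operatorname{supp}\Phi\subset\{0,2,\ldots,R\}$. Then, for all sufficiently large $N$, $$\lambda^{\mathrm{den}}_{x,N}(\Phi\circ h_K)=\int_X\Phi\circ h_K\,d\mu_X.$$
   Context: Let $q$ be a prime power, $F=\mathbb F_q((t^{-1}))$, $\mathcal O=\mathbb F_q[[t^{-1}]]$, $\pi=t^{-1}$, $G=\mathrm{SL}_2(F)$, $\Gamma=\mathrm{SL}_2(\mathbb F_q[t])$, $K=\mathrm{SL}_2(\mathcal O)$, $X=\Gamma\backslash G$, $\mu_X$ the normalized $G$-invariant probability measure on $X$. Put $u(s)=\begin{pmatrix}1&s\\0&1\end{pmatrix}$, and let $ds$ be Haar measure on $F$ with $ds(\mathcal O)=1$. For $N\ge0$, $\lambda^{\mathrm{den}}_{x,N}(f)=q^{-N}\int_{t^N\mathcal O}f(xu(s))\,ds$. $G$ acts on $\mathbb P^1(F)$ and $\infty=[1:0]$. Height map: $\mathcal T$ is the Bruhat--Tits tree of $\mathrm{PGL}_2(F)$ (vertices: homothety classes of $\mathcal O$-lattices in $F^2$; $[L],[L']$ adjacent if representatives satisfy $\pi L\subsetneq L'\subsetneq L$, $L/L'\simeq\mathbb F_q$). With $v_n=[\mathrm{diag}(t^n,1)]\cdot[\mathcal O^2]$, the quotient of $\mathcal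 T$ by $\mathrm{PGL}_2(\mathbb F_q[t])$ is the ray $v_0-v_1-\cdots$, and $h(v)$ is the $n\ge0$ for which $v$ lies in the orbit of $v_n$. $h_K:X\to2\mathbb Z_{\ge0}$, $h_K(\Gamma g)=h(gv_0)$. *)

theory Defs
  imports
    "HOL-Analysis.Analysis"
    "HOL-Probability.Probability_Measure"
    "HOL-Computational_Algebra.Formal_Laurent_Series"
    "HOL-Algebra.Coset"
begin

text \<open>
  A finite field of order \<open>q\<close> is a type \<open>'a :: {finite, field}\<close> with \<open>q = CARD('a)\<close>.  The field
  \<open>F\<close> of formal Laurent series in \<open>1/t\<close> is \<open>'a fls\<close>: the library variable \<^const>\<open>fls_X\<close> plays the
  role of \<open>\<pi> = 1/t\<close>, so that \<open>t\<close> is \<^const>\<open>fls_X_inv\<close>.  The metric topology of \<open>'a fls\<close> is the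
  valuation topology, and matrices over \<open>F\<close> carry the product topology.
\<close>

abbreviation tt :: "'a::{finite,field} fls" where
  "tt \<equiv> fls_X_inv"

definition int_ring :: "'a::{finite,field} fls set" where
  "int_ring = range fps_to_fls"

definition poly_ring :: "'a::{finite,field} fls set" where
  "poly_ring = range (\<lambda>p :: 'a poly. poly (map_poly fls_const p) tt)"

definition rat_field :: "'a::{finite,field} fls set" where
  "rat_field = {a / b | a b. a \<in> poly_ring \<and> b \<in> poly_ring \<and> b \<noteq> 0}"


subsection \<open>Groups and the space \<open>X\<close>\<close>

definition SL2F :: "('a::{finite,field} fls^2^2) monoid" where
  "SL2F = \<lparr>carrier = {A. det A = 1}, monoid.mult = (**), one = mat 1\<rparr>"

definition mats_over :: "'a::{finite,field} fls set \<Rightarrow> ('a fls^2^2) set" where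
  "mats_over S = {A. \<forall>i j. A $ i $ j \<in> S}"

definition Gam :: "('a::{finite,field} fls^2^2) set" where
  "Gam = carrier SL2F \<inter> mats_over poly_ring"

definition GL2_poly :: "('a::{finite,field} fls^2^2) set" where
  "GL2_poly = {A \<in> mats_over poly_ring. \<exists>B \<in> mats_over poly_ring. A ** B = mat 1 \<and> B ** A = mat 1}"

text \<open>Points of \<open>X\<close> are the cosets \<open>\<Gamma>g\<close>; the right action of \<open>g \<in> G\<close> sends \<open>x\<close> to \<open>x #> g\<close>.\<close>

definition coset :: "'a::{finite,field} fls^2^2 \<Rightarrow> ('a fls^2^2) set" where
  "coset g = Gam #>\<^bsub>SL2F\<^esub> g"

definition X_act :: "('a::{finite,field} fls^2^2) set \<Rightarrow> 'a fls^2^2 \<Rightarrow> ('a fls^2^2) set" where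
  "X_act x g = x #>\<^bsub>SL2F\<^esub> g"

definition XX :: "('a::{finite,field} fls^2^2) set set" where
  "XX = rcosets\<^bsub>SL2F\<^esub> Gam"

text \<open>
  The Borel structure of the quotient topology: a set \<open>U\<close> of cosets is open iff its preimage
  under \<open>G \<rightarrow> X\<close>, which is \<open>\<Union>U\<close>, is open in \<open>G\<close>.
\<close>

definition borel_X :: "('a::{finite,field} fls^2^2) set measure" where
  "borel_X = sigma XX {U. U \<subseteq> XX \<and> openin (top_of_set (carrier SL2F)) (\<Union>U)}"

definition invariant_prob_measure :: "('a::{finite,field} fls^2^2) set measure \<Rightarrow> bool" where
  "invariant_prob_measure \<mu> \<longleftrightarrow>
     prob_space \<mu> \<and> sets \<mu> = sets borel_X \<and>
     (\<forall>g \<in> carrier SL2F. \<forall>A \<in> sets \<mu>. emeasure \<mu> ((\<lambda>x. X_act x g) ` A) = emeasure \<mu> A)"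

text \<open>As \<open>F\<close> is locally compact and second countable, regularity is automatic.\<close>

definition haar_measure :: "'a::{finite,field} fls measure \<Rightarrow> bool" where
  "haar_measure \<nu> \<longleftrightarrow>
     sets \<nu> = sets borel \<and> emeasure \<nu> UNIV \<noteq> 0 \<and>
     (\<forall>C. compact C \<longrightarrow> emeasure \<nu> C < \<infinity>) \<and>
     (\<forall>a. \<forall>A \<in> sets \<nu>. emeasure \<nu> ((+) a ` A) = emeasure \<nu> A)"

definition uu :: "'a::{finite,field} fls \<Rightarrow> 'a fls^2^2" where
  "uu s = vector [vector [1, s], vector [0, 1]]"

definition lambda_den ::
  "'a::{finite,field} fls measure \<Rightarrow> ('a fls^2^2) set \<Rightarrow> nat \<Rightarrow> (('a fls^2^2) set \<Rightarrow> complex) \<Rightarrow> complex"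
  where
  "lambda_den ds x N f =
     inverse (of_nat CARD('a) ^ N) * (\<integral>s \<in> (*) (tt ^ N) ` int_ring. f (X_act x (uu s)) \<partial>ds)"


subsection \<open>The projective line\<close>

text \<open>A point \<open>[a:b]\<close> is the line spanned by the column vector \<open>(a, b)\<close>.\<close>

definition proj_pt :: "'a::{finite,field} fls \<Rightarrow> 'a fls \<Rightarrow> ('a fls^2) set" where
  "proj_pt a b = vec.span {vector [a, b]}"

definition P1_rat :: "('a::{finite,field} fls^2) set set" where
  "P1_rat = {proj_pt a b | a b. a \<in> rat_field \<and> b \<in> rat_field \<and> (a, b) \<noteq> (0, 0)}"

definition xi :: "'a::{finite,field} fls^2^2 \<Rightarrow> ('a fls^2) set" where
  "xi g = (*v) g ` proj_pt 1 0"


subsection \<open>Vertices of the Bruhat--Tits tree and the height\<close>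

definition O_span :: "('a::{finite,field} fls^2) set \<Rightarrow> ('a fls^2) set" where
  "O_span S = {\<Sum>v\<in>S. c v *s v | c. c \<in> S \<rightarrow> int_ring}"

definition lattices :: "('a::{finite,field} fls^2) set set" where
  "lattices = {L. (\<exists>S. finite S \<and> L = O_span S) \<and> vec.span L = UNIV}"

definition homothety :: "('a::{finite,field} fls^2) set rel" where
  "homothety = {(L, L'). L \<in> lattices \<and> L' \<in> lattices \<and> (\<exists>c. c \<noteq> 0 \<and> L' = (*s) c ` L)}"

definition std_lattice :: "('a::{finite,field} fls^2) set" where
  "std_lattice = {v. \<forall>i. v $ i \<in> int_ring}"

text \<open>
  The vertices are the elements of \<open>lattices // homothety\<close>.  A vertex is thus a set of lattices,
  and matrices act by taking images.  Scalars act trivially, so the orbits of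
  \<open>PGL\<^sub>2\<close> over the polynomial ring are those of \<open>GL\<^sub>2\<close>.
\<close>

definition vertex_act ::
  "'a::{finite,field} fls^2^2 \<Rightarrow> ('a fls^2) set set \<Rightarrow> ('a fls^2) set set" where
  "vertex_act A v = (\<lambda>L. (*v) A ` L) ` v"

definition vv :: "nat \<Rightarrow> ('a::{finite,field} fls^2) set set" where
  "vv n = vertex_act (vector [vector [tt ^ n, 0], vector [0, 1]]) (homothety `` {std_lattice})"

definition height :: "('a::{finite,field} fls^2) set set \<Rightarrow> nat" where
  "height v = (THE n. \<exists>\<gamma> \<in> GL2_poly. v = vertex_act \<gamma> (vv n))"

text \<open>The value of \<open>g \<mapsto> height (g v\<^sub>0)\<close> on the coset \<open>x\<close>, on which it is constant.\<close>

definition hK :: "('a::{finite,field} fls^2^2) set \<Rightarrow> nat" where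
  "hK x = the_elem ((\<lambda>g. height (vertex_act g (vv 0))) ` x)"

end

theory Submission
  imports Defs
begin

text \<open>Write \<open>q\<close> for the order of the field and \<open>v\<^sub>0\<close> for the vertex of the standard lattice.  Everything rests on
one fact about the tree: a vertex of height \<open>0\<close> has \<open>q + 1\<close> neighbours of height \<open>1\<close>, and a vertex
of height \<open>n > 0\<close> has one neighbour of height \<open>n + 1\<close> and \<open>q\<close> of height \<open>n - 1\<close>
(\<open>ht_nbr_zero\<close>, \<open>ht_nbr_Suc\<close>).  The heights seen along non-backtracking walks are therefore those of
a walk on the half-line, and both sides of the identity can be computed exactly.

The left side.  The vertices \<open>g u(s) v\<^sub>0\<close> with \<open>s\<close> in \<open>t\<^sup>N \<O>\<close>, one for each residue of \<open>s\<close> modulo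
\<open>\<O>\<close>, are the \<open>q\<^sup>N\<close> vertices reached from \<open>g diag(t\<^sup>N, 1) v\<^sub>0\<close> by \<open>N\<close> steps that never go towards the
end \<open>g\<infinity>\<close>.  So the average over \<open>t\<^sup>N \<O>\<close> is a count of descendants (\<open>emeasure_high_shifts\<close>).  Such a
walk may climb for a while, then has to descend to height \<open>0\<close>, and there starts afresh.  This makes
the count independent of the starting vertex: for \<open>J > 0\<close>, exactly \<open>q\<^bsup>N + 1 - J\<^esup>\<close> descendants have
height at least \<open>J\<close>, provided that the height of the starting vertex is at most \<open>N - J\<close> and has
the parity of \<open>N - J\<close> (\<open>high_descendants_far\<close>).  The height of \<open>g diag(t\<^sup>N, 1) v\<^sub>0\<close> changes by
one with each \<open>N\<close>; if it increased from some point on, the ray towards \<open>g\<infinity>\<close> would run into a cusp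
and \<open>g\<infinity>\<close> would be rational.  For irrational \<open>g\<infinity>\<close> it decreases infinitely often, hence the
difference between \<open>N\<close> and this height tends to infinity (\<open>irrational_height_gap\<close>).

The right side.  By invariance, the law of the height under \<open>\<mu>\<close> does not change when \<open>v\<^sub>0\<close> is
replaced by a vertex two steps away, since such a step is realised by an element of determinant
one.  Averaging over the \<open>(q + 1)\<^sup>2\<close> pairs of steps shows that the law is stationary for a walk on
the even heights, which for a walk on a half-line means detailed balance (\<open>detailed_balance\<close>).
This recursion and total mass one leave a single candidate (\<open>measure_hK\<close>), and it agrees with the
law of the descendants.  As \<open>\<Phi>\<close> sees only finitely many heights, the two integrals agree as soon
as \<open>N\<close> is large enough for each of these heights.\<close>

no_notation fps_nth (infixl "$" 75)
notation fls_nth (infixl "$$" 75)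

section \<open>The rings and the matrix groups\<close>

text \<open>Convenient because the subdegree of \<open>0\<close> is \<open>0\<close>, so that no case distinction is needed.\<close>
lemma int_ring_iff: "x \<in> int_ring \<longleftrightarrow> 0 \<le> fls_subdegree x"
proof
  assume "0 \<le> fls_subdegree x"
  then have "x = fps_to_fls (fls_regpart x)"
    by (intro fls_eqI) auto
  then show "x \<in> int_ring" unfolding int_ring_def by blast
qed (auto simp: int_ring_def fls_subdegree_fls_to_fps)

lemma int_ring_nth: "x \<in> int_ring \<longleftrightarrow> (\<forall>n<0. x $$ n = 0)"
  unfolding int_ring_iff using fls_subdegree_ge0I by auto

lemma int_ring_closed [simp]:
  "0 \<in> int_ring" "1 \<in> int_ring" "fls_const c \<in> int_ring" "fls_X \<in> int_ring"
  "x \<in> int_ring \<Longrightarrow> y \<in> int_ring \<Longrightarrow> x + y \<in> int_ring"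
  "x \<in> int_ring \<Longrightarrow> y \<in> int_ring \<Longrightarrow> x - y \<in> int_ring"
  "x \<in> int_ring \<Longrightarrow> - x \<in> int_ring"
  by (auto simp: int_ring_nth)

lemma int_ring_mult [simp]:
  "x \<in> int_ring \<Longrightarrow> y \<in> int_ring \<Longrightarrow> x * y \<in> int_ring"
  by (simp add: int_ring_iff fls_mult_subdegree_ge_0)

lemma poly_tt_nth:
  "poly (map_poly fls_const p) tt $$ n = (if n \<le> 0 then coeff p (nat (- n)) else 0)"
proof (induction p arbitrary: n)
  case (pCons a p)
  then show ?case
    by (cases "n < 0")
       (auto simp: map_poly_pCons fls_X_inv_times_conv_shift coeff_pCons nat_diff_distrib split: nat.splits
             intro!: arg_cong[of _ _ "coeff p"])
qed simp

text \<open>A Laurent series in \<open>1/t\<close> has only finitely many terms with positive powers of \<open>t\<close>, so the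
  absence of negative powers of \<open>t\<close> already forces it to be a polynomial.\<close>
lemma poly_ring_nth: "x \<in> poly_ring \<longleftrightarrow> (\<forall>n>0. x $$ n = 0)"
proof
  assume x: "\<forall>n>0. x $$ n = 0"
  define d where "d = nat (- fls_subdegree x)"
  define p where "p = Poly (map (\<lambda>i. x $$ (- int i)) [0..<Suc d])"
  have "x = poly (map_poly fls_const p) tt"
  proof (rule fls_eqI)
    fix n
    show "x $$ n = poly (map_poly fls_const p) tt $$ n"
      using x by (cases "n < fls_subdegree x")
        (auto simp: poly_tt_nth p_def nth_default_def d_def simp del: upt_Suc)
  qed
  then show "x \<in> poly_ring" unfolding poly_ring_def by blast
qed (auto simp: poly_ring_def poly_tt_nth)

lemma poly_ring_closed [simp]:
  "0 \<in> poly_ring" "1 \<in> poly_ring" "fls_const c \<in> poly_ring" "tt ^ n \<in> poly_ring"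
  "x \<in> poly_ring \<Longrightarrow> y \<in> poly_ring \<Longrightarrow> x + y \<in> poly_ring"
  "x \<in> poly_ring \<Longrightarrow> y \<in> poly_ring \<Longrightarrow> x - y \<in> poly_ring"
  "x \<in> poly_ring \<Longrightarrow> - x \<in> poly_ring"
  by (auto simp: poly_ring_nth)

lemma poly_ring_mult [simp]:
  assumes "x \<in> poly_ring" "y \<in> poly_ring" shows "x * y \<in> poly_ring"
  unfolding poly_ring_nth fls_times_nth(2)
proof (intro allI impI sum.neutral ballI)
  fix n i :: int assume "0 < n"
  then have "0 < i \<or> 0 < n - i" by linarith
  with assms show "x $$ i * y $$ (n - i) = 0" unfolding poly_ring_nth by auto
qed

text \<open>Together with \<open>int_ring_iff\<close> this expresses the discreteness of the polynomials: a polynomial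
  that is small in the valuation is \<open>0\<close>.\<close>
lemma poly_ring_subdegree:
  assumes "x \<in> poly_ring" shows "fls_subdegree x \<le> 0"
  using assms unfolding poly_ring_nth by (metis fls_zero_subdegree linorder_not_le nth_fls_subdegree_zero_iff order_refl)


definition mat2 :: "'b \<Rightarrow> 'b \<Rightarrow> 'b \<Rightarrow> 'b \<Rightarrow> 'b::zero^2^2" where
  "mat2 a b c d = vector [vector [a, b], vector [c, d]]"

lemma mat2_nth [simp]:
  "mat2 a b c d $ 1 $ 1 = a" "mat2 a b c d $ 1 $ 2 = b"
  "mat2 a b c d $ 2 $ 1 = c" "mat2 a b c d $ 2 $ 2 = d"
  by (simp_all add: mat2_def)

lemma mat2_eq_iff [simp]: "mat2 a b c d = mat2 a' b' c' d' \<longleftrightarrow> a = a' \<and> b = b' \<and> c = c' \<and> d = d'"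
  by (metis mat2_nth)

lemma mat2_eta: "mat2 (A $ 1 $ 1) (A $ 1 $ 2) (A $ 2 $ 1) (A $ 2 $ 2) = A"
  by (simp add: vec_eq_iff forall_2)

lemma mat2_cases: obtains a b c d where "A = mat2 a b c d"
  by (metis mat2_eta)

lemma mat2_mult [simp]:
  fixes a :: "'b::semiring_1"
  shows "mat2 a b c d ** mat2 a' b' c' d' =
    mat2 (a * a' + b * c') (a * b' + b * d') (c * a' + d * c') (c * b' + d * d')"
  by (simp add: vec_eq_iff forall_2 matrix_matrix_mult_def sum_2)

lemma mat_mat2: "mat z = mat2 z 0 0 z"
  by (simp add: vec_eq_iff forall_2 mat_def)

lemma det_mat2 [simp]: "det (mat2 a b c d) = a * d - b * c"
  by (simp add: det_2)

lemma mat2_vec: "mat2 a b c d *v v = vector [a * v$1 + b * v$2, c * v$1 + d * v$2]"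
  by (simp add: vec_eq_iff forall_2 matrix_vector_mult_def sum_2)

lemma mat_commute: "A ** mat z = mat (z::'b::comm_semiring_1) ** (A::'b^2^2)"
  by (cases A rule: mat2_cases) (simp add: mat_mat2 mult.commute)

lemma mats_over_mat2: "mat2 a b c d \<in> mats_over S \<longleftrightarrow> a \<in> S \<and> b \<in> S \<and> c \<in> S \<and> d \<in> S"
  by (auto simp: mats_over_def forall_2)

text \<open>The stabiliser of the standard lattice.  It is described by the determinant, because this is what
  the explicit matrices below make easy to check.\<close>
definition GL2_int :: "('a::{finite,field} fls^2^2) set" where
  "GL2_int = {A \<in> mats_over int_ring. det A \<noteq> 0 \<and> fls_subdegree (det A) = 0}"

lemma GL2_int_mat2: "mat2 a b c d \<in> GL2_int \<longleftrightarrow> 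
   a \<in> int_ring \<and> b \<in> int_ring \<and> c \<in> int_ring \<and> d \<in> int_ring \<and> a*d-b*c \<noteq> 0 \<and> fls_subdegree (a*d-b*c) = 0"
  by (auto simp: GL2_int_def mats_over_mat2)

lemma GL2_int_mult: "A \<in> GL2_int \<Longrightarrow> B \<in> GL2_int \<Longrightarrow> A ** B \<in> GL2_int"
  unfolding GL2_int_def
  by (cases A rule: mat2_cases, cases B rule: mat2_cases)
     (auto simp: mats_over_mat2 det_mul simp del: det_mat2 mat2_mult, auto simp: mats_over_mat2)

lemma GL2_int_one [simp]: "mat 1 \<in> GL2_int"
  by (simp add: mat_mat2 GL2_int_mat2)

lemma GL2_int_inverse:
  assumes "A \<in> GL2_int" obtains B where "B \<in> GL2_int" "A ** B = mat 1" "B ** A = mat 1"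
proof -
  obtain a b c d where A: "A = mat2 a b c d" by (rule mat2_cases)
  define E where "E = inverse (a*d-b*c)"
  have *: "a \<in> int_ring" "b \<in> int_ring" "c \<in> int_ring" "d \<in> int_ring"
      "E \<noteq> 0" "fls_subdegree E = 0" and E: "E * (a*d-b*c) = 1"
    using assms by (auto simp: A GL2_int_mat2 E_def)
  then have "E \<in> int_ring" by (simp add: int_ring_iff)
  let ?B = "mat2 (E * d) (E * (-b)) (E * (-c)) (E * a)"
  have "E * d * (E * a) - E * (-b) * (E * (-c)) = E * (E * (a*d-b*c))"
    by (simp add: algebra_simps)
  then have "?B \<in> GL2_int" unfolding GL2_int_mat2 E
    using * \<open>E \<in> int_ring\<close> by auto
  moreover have "A ** ?B = mat 1" "?B ** A = mat 1"
    using E unfolding A mat2_mult mat_mat2 mat2_eq_iff by (simp_all add: algebra_simps)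
  ultimately show ?thesis using that by blast
qed

lemma mats_over_poly_mult:
  "A \<in> mats_over poly_ring \<Longrightarrow> B \<in> mats_over poly_ring \<Longrightarrow> A ** B \<in> mats_over poly_ring"
  by (cases A rule: mat2_cases, cases B rule: mat2_cases) (auto simp: mats_over_mat2)

lemma GL2_poly_inverse:
  assumes "A \<in> GL2_poly" obtains B where "B \<in> GL2_poly" "A ** B = mat 1" "B ** A = mat 1"
  using assms unfolding GL2_poly_def by blast

lemma GL2_poly_mult:
  assumes "A \<in> GL2_poly" "B \<in> GL2_poly" shows "A ** B \<in> GL2_poly"
proof -
  obtain A' B' where *: "A' \<in> GL2_poly" "A ** A' = mat 1" "A' ** A = mat 1" "B' \<in> GL2_poly" "B ** B' = mat 1" "B' ** B = mat 1"
    using assms GL2_poly_inverse by metis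
  then have "A ** B ** (B' ** A') = mat 1" "B' ** A' ** (A ** B) = mat 1"
    by (metis matrix_mul_assoc matrix_mul_rid)+
  with assms * show ?thesis unfolding GL2_poly_def using mats_over_poly_mult by blast
qed

text \<open>The determinant and its inverse are polynomials, so neither has positive valuation.\<close>
lemma GL2_poly_det:
  assumes "A \<in> GL2_poly" shows "det A \<noteq> 0" "fls_subdegree (det A) = 0"
proof -
  obtain B where B: "B \<in> GL2_poly" "A ** B = mat 1" using assms GL2_poly_inverse by metis
  have d: "det A * det B = 1" using B(2) by (metis det_mul det_I)
  then show "det A \<noteq> 0" by auto
  have p: "det C \<in> poly_ring" if "C \<in> GL2_poly" for C :: "'a fls^2^2"
    using that by (cases C rule: mat2_cases) (auto simp: GL2_poly_def mats_over_mat2)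
  have "fls_subdegree (det A) \<le> 0" "fls_subdegree (det B) \<le> 0"
    using p assms B(1) poly_ring_subdegree by blast+
  moreover have "fls_subdegree (det A) + fls_subdegree (det B) = 0"
    using d fls_subdegree_mult[of "det A" "det B"] by (metis fls_one_subdegree mult_zero_left mult_zero_right zero_neq_one)
  ultimately show "fls_subdegree (det A) = 0" by linarith
qed

lemma GL2_polyI:
  assumes "A \<in> mats_over poly_ring" "det A = 1 \<or> det A = -1" shows "A \<in> GL2_poly"
proof -
  obtain a b c d where A: "A = mat2 a b c d" by (rule mat2_cases)
  define D where "D = a*d-b*c"
  have D: "D * D = 1" "D \<in> poly_ring" using assms by (auto simp: A D_def mats_over_mat2)
  let ?B = "mat2 (D * d) (D * (-b)) (D * (-c)) (D * a)"
  have "D * (a*d-b*c) = 1" using D D_def by simp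
  then have "A ** ?B = mat 1" "?B ** A = mat 1"
    unfolding A mat2_mult mat_mat2 mat2_eq_iff by (simp_all add: algebra_simps)
  moreover have "?B \<in> mats_over poly_ring" using D assms by (auto simp: A mats_over_mat2)
  ultimately show ?thesis using assms unfolding GL2_poly_def by blast
qed


section \<open>Neighbours in the tree\<close>

lemma mat_shift: "A ** mat z ** B = A ** B ** mat z" for A B :: "'b::comm_semiring_1^2^2"
  by (simp only: mat_commute[of B z] flip: matrix_mul_assoc)

lemma mat_mat: "A ** mat y ** mat z = A ** mat (y * z)" for A :: "'b::comm_semiring_1^2^2"
proof -
  have "mat y ** mat z = (mat (y * z) :: 'b^2^2)" by (simp add: mat_mat2)
  then show ?thesis by (simp only: flip: matrix_mul_assoc)
qed

lemma X_tt [simp]: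
  fixes y :: "'a::{finite,field} fls"
  shows "fls_X * tt = (1 :: 'a fls)" "tt * fls_X = (1 :: 'a fls)"
    "fls_X * (tt * y) = y" "tt * (fls_X * y) = y"
proof -
  show 1: "fls_X * tt = (1 :: 'a fls)" by (metis fls_X_nonzero fls_inverse_X right_inverse)
  then show 2: "tt * fls_X = (1 :: 'a fls)" by (metis mult.commute)
  show "fls_X * (tt * y) = y" by (metis 1 mult.assoc mult_1_left)
  show "tt * (fls_X * y) = y" by (metis 2 mult.assoc mult_1_left)
qed

lemma tt_mult_int:
  assumes "x \<in> int_ring" "x $$ 0 = 0" shows "x * tt \<in> int_ring"
  unfolding int_ring_nth
proof (intro allI impI)
  fix n :: int assume "n < 0"
  then have "x $$ (n + 1) = 0" using assms unfolding int_ring_nth by (cases "n = -1") auto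
  then show "(x * tt) $$ n = 0" by (simp add: fls_X_inv_times_conv_shift)
qed

lemma int_ring_mult_nth0:
  assumes "x \<in> int_ring" "y \<in> int_ring" shows "(x * y) $$ 0 = x $$ 0 * y $$ 0"
proof -
  obtain f g where "x = fps_to_fls f" "y = fps_to_fls g" using assms unfolding int_ring_def by blast
  then have "x * y = fps_to_fls (f * g)" "x $$ 0 = fps_nth f 0" "y $$ 0 = fps_nth g 0"
    by (simp_all only: fls_times_fps_to_fls) simp_all
  then show ?thesis by simp
qed

text \<open>The vertices adjacent to the one represented by \<open>w\<close> are represented by \<open>w ** nbr i\<close>.  The index
  \<open>None\<close> stands for the neighbour in the direction of the end \<open>w\<infinity>\<close>, the index \<open>Some c\<close> for the
  remaining \<open>q\<close> ones.  The index is thus a point of the projective line over the residue field.\<close>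
definition nbr :: "'a::{finite,field} option \<Rightarrow> 'a fls^2^2" where
  "nbr i = (case i of None \<Rightarrow> mat2 tt 0 0 1 | Some c \<Rightarrow> mat2 fls_X (fls_const c) 0 1)"

lemma GL2_int_D: 
  assumes "mat2 a b c d \<in> GL2_int"
  shows "a \<in> int_ring" "b \<in> int_ring" "c \<in> int_ring" "d \<in> int_ring"
  using assms by (auto simp: GL2_int_mat2)

text \<open>Multiplication by \<open>k\<close> acts on the neighbours of the standard vertex as the reduction of \<open>k\<close> acts on
  the projective line over the residue field.  The four cases are those in which the point and its
  image are finite or infinite; the scalar \<open>z\<close> compensates the different determinants of the
  neighbour matrices.\<close>
lemma nbr_permute_ex:
  assumes "k \<in> GL2_int"
  shows "\<exists>j. \<exists>k'\<in>GL2_int. \<exists>z. z \<noteq> 0 \<and> k ** nbr i = nbr j ** k' ** mat z"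
proof -
  obtain a b c d where k: "k = mat2 a b c d" by (rule mat2_cases)
  note int = GL2_int_D[OF assms[unfolded k]]
  define D where "D = a * d - b * c"
  have D: "D \<noteq> 0" "fls_subdegree D = 0" using assms by (auto simp: k GL2_int_mat2 D_def)
  show ?thesis
  proof (cases i)
    case None
    show ?thesis
    proof (cases "c $$ 0 = 0")
      case True
      let ?k = "mat2 a (fls_X * b) (c * tt) d"
      have "det ?k = D" by (simp add: D_def algebra_simps)
      then have "?k \<in> GL2_int" using int D tt_mult_int[OF int(3) True] by (auto simp: GL2_int_mat2)
      moreover have "k ** nbr i = nbr None ** ?k ** mat 1"
        by (simp add: nbr_def None k mat_mat2 algebra_simps)
      ultimately show ?thesis using one_neq_zero by blast
    next
      case False
      define e where "e = fls_const (a $$ 0 / c $$ 0)"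
      have "(a - e * c) $$ 0 = 0" using False by (simp add: e_def int_ring_mult_nth0 int)
      then have "(a - e * c) * tt \<in> int_ring" using int by (intro tt_mult_int) (auto simp: e_def)
      moreover let ?k = "mat2 ((a - e * c) * tt) (b - e * d) c (fls_X * d)"
      have "det ?k = D" by (simp add: D_def algebra_simps)
      ultimately have "?k \<in> GL2_int" using int D by (auto simp: GL2_int_mat2 e_def)
      moreover have "k ** nbr i = nbr (Some (a $$ 0 / c $$ 0)) ** ?k ** mat tt"
        by (simp add: nbr_def None k mat_mat2 algebra_simps flip: e_def)
      ultimately show ?thesis using fls_X_inv_nonzero by blast
    qed
  next
    case (Some f)
    define r where "r = a * fls_const f + b"
    define s where "s = c * fls_const f + d"
    have rs: "r \<in> int_ring" "s \<in> int_ring" using int by (auto simp: r_def s_def)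
    show ?thesis
    proof (cases "s $$ 0 = 0")
      case True
      let ?k = "mat2 (a * fls_X) r c (s * tt)"
      have "det ?k = D" by (simp add: D_def r_def s_def algebra_simps)
      then have "?k \<in> GL2_int" using int rs D tt_mult_int[OF rs(2) True] by (auto simp: GL2_int_mat2)
      moreover have "k ** nbr i = nbr None ** ?k ** mat fls_X"
        by (simp add: nbr_def Some k mat_mat2 algebra_simps r_def s_def)
      ultimately show ?thesis using fls_X_nonzero by blast
    next
      case False
      define e where "e = fls_const (r $$ 0 / s $$ 0)"
      have "(r - e * s) $$ 0 = 0" using False by (simp add: e_def int_ring_mult_nth0 rs)
      then have "(r - e * s) * tt \<in> int_ring" using rs by (intro tt_mult_int) (auto simp: e_def)
      moreover let ?k = "mat2 (a - e * c) ((r - e * s) * tt) (c * fls_X) s"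
      have "det ?k = D" by (simp add: D_def r_def s_def algebra_simps)
      ultimately have "?k \<in> GL2_int" using int rs D by (auto simp: GL2_int_mat2 e_def)
      moreover have n: "nbr (Some (r $$ 0 / s $$ 0)) = mat2 fls_X e 0 1"
        by (simp add: nbr_def e_def)
      have "k ** nbr i = nbr (Some (r $$ 0 / s $$ 0)) ** ?k ** mat 1"
        unfolding n by (simp add: nbr_def Some k mat_mat2 algebra_simps r_def s_def)
      ultimately show ?thesis using one_neq_zero by blast
    qed
  qed
qed

lemma nbr_distinct:
  assumes "k \<in> GL2_int" "nbr i' = nbr i ** k ** mat z"
  shows "i = i'"
proof -
  obtain p q r s where k: "k = mat2 p q r s" by (rule mat2_cases)
  note int = GL2_int_D[OF assms(1)[unfolded k]]
  have e: "r * z = 0" "s * z = 1"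
    using assms(2) by (auto simp: k mat_mat2 nbr_def split: option.splits)
  then have nz: "r = 0" "s \<noteq> 0" "z \<noteq> 0" by auto
  then have "p \<noteq> 0" "fls_subdegree (p * s) = 0" using assms(1) by (auto simp: k GL2_int_mat2)
  then have v: "fls_subdegree p = 0" "fls_subdegree s = 0"
    using int nz by (simp_all add: int_ring_iff)
  have vz: "fls_subdegree z = 0"
    using arg_cong[OF e(2), of fls_subdegree] nz v by simp
  have vX: "fls_subdegree (fls_X * p * z) = 1" "fls_subdegree (tt * p * z) = -1"
    using v vz nz \<open>p \<noteq> 0\<close> by simp_all
  show ?thesis
  proof (cases i; cases i')
    fix c assume "i = None" "i' = Some c"
    then have "fls_X = tt * p * z" using assms(2) by (simp add: nbr_def k mat_mat2)
    with vX have False by (metis fls_X_subdegree one_neq_neg_one)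
    then show ?thesis ..
  next
    fix c assume "i = Some c" "i' = None"
    then have "tt = fls_X * p * z" using assms(2) nz by (simp add: nbr_def k mat_mat2)
    with vX have False by (metis fls_X_inv_subdegree one_neq_neg_one)
    then show ?thesis ..
  next
    fix c d assume i: "i = Some c" "i' = Some d"
    then have "fls_const d = fls_X * (q * z) + fls_const c * (s * z)"
      using assms(2) by (simp add: nbr_def k mat_mat2 algebra_simps)
    then have "fls_const (d - c) = fls_X * (q * z)" using e(2) by (simp flip: fls_minus_const)
    moreover have "(fls_X * (q * z)) $$ 0 = fls_X $$ 0 * (q * z) $$ 0"
      using int vz by (intro int_ring_mult_nth0) (auto simp: int_ring_iff intro!: fls_mult_subdegree_ge_0)
    ultimately have "fls_const (d - c) $$ 0 = 0" by simp
    then show ?thesis using i by simp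
  qed simp
qed

text \<open>Distinct indices give distinct vertices, so the action on the finite index set is injective and
  hence a permutation.\<close>
lemma nbr_permute:
  assumes "k \<in> GL2_int"
  obtains \<sigma> where "bij \<sigma>" "\<forall>i. \<exists>k'\<in>GL2_int. \<exists>z. z \<noteq> 0 \<and> k ** nbr i = nbr (\<sigma> i) ** k' ** mat z"
proof -
  obtain \<sigma> where \<sigma>: "\<And>i. \<exists>k'\<in>GL2_int. \<exists>z. z \<noteq> 0 \<and> k ** nbr i = nbr (\<sigma> i) ** k' ** mat z"
    using nbr_permute_ex[OF assms] by metis
  have "inj \<sigma>"
  proof (rule injI)
    fix i j assume ij: "\<sigma> i = \<sigma> j"
    obtain k1 z1 where 1: "k1 \<in> GL2_int" "z1 \<noteq> 0" "k ** nbr i = nbr (\<sigma> i) ** k1 ** mat z1"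
      using \<sigma> by blast
    obtain k2 z2 where 2: "k2 \<in> GL2_int" "z2 \<noteq> 0" "k ** nbr j = nbr (\<sigma> i) ** k2 ** mat z2"
      using \<sigma> ij by metis
    obtain k1' where k1': "k1' \<in> GL2_int" "k1 ** k1' = mat 1" using GL2_int_inverse[OF 1(1)] by metis
    obtain k' where k': "k' ** k = mat 1" using GL2_int_inverse[OF assms] by metis
    have "nbr (\<sigma> i) = nbr (\<sigma> i) ** (k1 ** k1') ** mat (z1 * inverse z1)"
      using 1 k1' by simp
    also have "\<dots> = nbr (\<sigma> i) ** k1 ** mat z1 ** k1' ** mat (inverse z1)"
      by (simp only: mat_shift[of _ z1 k1'] mat_mat matrix_mul_assoc)
    also have "\<dots> = k ** nbr i ** k1' ** mat (inverse z1)"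
      using 1 by simp
    finally have "k ** nbr j = k ** nbr i ** k1' ** mat (inverse z1) ** k2 ** mat z2"
      using 2 by simp
    also have "\<dots> = k ** (nbr i ** (k1' ** k2) ** mat (inverse z1 * z2))"
      by (simp only: mat_shift[of _ "inverse z1" k2] mat_mat matrix_mul_assoc)
    finally have "k ** nbr j = k ** (nbr i ** (k1' ** k2) ** mat (inverse z1 * z2))" .
    then have "k' ** k ** nbr j = k' ** k ** (nbr i ** (k1' ** k2) ** mat (inverse z1 * z2))"
      by (simp only: flip: matrix_mul_assoc)
    then have "nbr j = nbr i ** (k1' ** k2) ** mat (inverse z1 * z2)"
      by (simp only: k' matrix_mul_lid)
    then show "i = j" by (rule nbr_distinct[OF GL2_int_mult[OF k1'(1) 2(1)]])
  qed
  then have "bij \<sigma>" by (simp add: bij_def finite_UNIV_inj_surj)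
  with \<sigma> that show ?thesis by blast
qed

text \<open>States that \<open>w\<close> and \<open>\<gamma> diag(t\<^sup>n, 1)\<close> define the same vertex: matrices that differ by a right factor
  from the stabiliser of the standard lattice and a scalar do so.  The matrix \<open>\<gamma>\<close> is kept as a
  parameter because along a ray running into a cusp it stays the same.\<close>
definition represents :: "'a::{finite,field} fls^2^2 \<Rightarrow> 'a fls^2^2 \<Rightarrow> nat \<Rightarrow> bool" where
  "represents \<gamma> w n \<longleftrightarrow> (\<exists>k\<in>GL2_int. \<exists>z. z \<noteq> 0 \<and> w = \<gamma> ** mat2 (tt ^ n) 0 0 1 ** k ** mat z)"

definition has_height :: "'a::{finite,field} fls^2^2 \<Rightarrow> nat \<Rightarrow> bool" where
  "has_height w n \<longleftrightarrow> (\<exists>\<gamma>\<in>GL2_poly. represents \<gamma> w n)"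

lemma representsI: "k \<in> GL2_int \<Longrightarrow> z \<noteq> 0 \<Longrightarrow> w = \<gamma> ** mat2 (tt ^ n) 0 0 1 ** k ** mat z \<Longrightarrow> represents \<gamma> w n"
  unfolding represents_def by (rule bexI, rule exI, rule conjI)

lemma representsE:
  assumes "represents \<gamma> w n"
  obtains k z where "k \<in> GL2_int" "z \<noteq> 0" "w = \<gamma> ** mat2 (tt ^ n) 0 0 1 ** k ** mat z"
  using assms unfolding represents_def by (elim bexE exE conjE)

lemma represents_mult:
  assumes "represents \<gamma> w n" "k \<in> GL2_int" "z \<noteq> 0"
  shows "represents \<gamma> (w ** k ** mat z) n"
proof -
  obtain l y where l: "l \<in> GL2_int" "y \<noteq> 0" "w = \<gamma> ** mat2 (tt ^ n) 0 0 1 ** l ** mat y"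
    using assms(1) by (rule representsE)
  have *: "w ** k ** mat z = \<gamma> ** mat2 (tt ^ n) 0 0 1 ** (l ** k) ** mat (y * z)"
    by (simp only: l mat_shift[of _ y k] mat_mat matrix_mul_assoc)
  show ?thesis
    by (rule representsI[OF GL2_int_mult[OF l(1) assms(2)] _ *]) (use l(2) assms(3) in simp)
qed

lemma represents_base: "represents \<gamma> (\<gamma> ** mat2 (tt ^ n) 0 0 1) n"
proof -
  have *: "\<gamma> ** mat2 (tt ^ n) 0 0 1 = \<gamma> ** mat2 (tt ^ n) 0 0 1 ** mat 1 ** mat 1" by simp
  show ?thesis by (rule representsI[OF GL2_int_one _ *]) simp
qed

text \<open>Neighbours of \<open>w\<close> may be computed at \<open>\<gamma> diag(t\<^sup>n, 1)\<close> instead: the factor from the stabiliser only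
  permutes them.\<close>
lemma represents_nbr_cases:
  assumes "represents \<gamma> w n"
  obtains \<sigma> where "bij \<sigma>"
    "\<forall>i m \<gamma>'. represents \<gamma>' (\<gamma> ** mat2 (tt ^ n) 0 0 1 ** nbr (\<sigma> i)) m \<longrightarrow> represents \<gamma>' (w ** nbr i) m"
proof -
  obtain k y where k: "k \<in> GL2_int" "y \<noteq> 0" "w = \<gamma> ** mat2 (tt ^ n) 0 0 1 ** k ** mat y"
    using assms by (rule representsE)
  obtain \<sigma> where \<sigma>: "bij \<sigma>" "\<forall>i. \<exists>k'\<in>GL2_int. \<exists>z. z \<noteq> 0 \<and> k ** nbr i = nbr (\<sigma> i) ** k' ** mat z"
    by (rule nbr_permute[OF k(1)])
  show ?thesis
  proof (rule that[OF \<sigma>(1)], intro allI impI)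
    fix i m \<gamma>'
    assume r: "represents \<gamma>' (\<gamma> ** mat2 (tt ^ n) 0 0 1 ** nbr (\<sigma> i)) m"
    obtain k' z where k': "k' \<in> GL2_int" "z \<noteq> 0" "k ** nbr i = nbr (\<sigma> i) ** k' ** mat z"
      using \<sigma>(2)[rule_format, of i] by (elim bexE exE conjE)
    have "w ** nbr i = \<gamma> ** mat2 (tt ^ n) 0 0 1 ** (k ** nbr i) ** mat y"
      by (simp only: k(3) mat_shift[of _ y "nbr i"] matrix_mul_assoc)
    also have "\<dots> = \<gamma> ** mat2 (tt ^ n) 0 0 1 ** nbr (\<sigma> i) ** k' ** mat (z * y)"
      by (simp only: k'(3) mat_mat matrix_mul_assoc)
    finally have *: "w ** nbr i = \<gamma> ** mat2 (tt ^ n) 0 0 1 ** nbr (\<sigma> i) ** k' ** mat (z * y)" .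
    show "represents \<gamma>' (w ** nbr i) m"
      unfolding * by (rule represents_mult[OF r k'(1)]) (use k(2) k'(2) in simp)
  qed
qed

lemma represents_left:
  assumes "represents \<gamma>' w n" shows "represents (\<gamma> ** \<gamma>') (\<gamma> ** w) n"
proof -
  obtain k y where k: "k \<in> GL2_int" "y \<noteq> 0" "w = \<gamma>' ** mat2 (tt ^ n) 0 0 1 ** k ** mat y"
    using assms by (rule representsE)
  show ?thesis by (rule representsI[OF k(1,2)]) (simp only: k(3) matrix_mul_assoc)
qed

lemma has_heightI: "\<gamma> \<in> GL2_poly \<Longrightarrow> represents \<gamma> w n \<Longrightarrow> has_height w n"
  unfolding has_height_def by (rule bexI)

lemma has_heightE: 
  assumes "has_height w n" obtains \<gamma> where "\<gamma> \<in> GL2_poly" "represents \<gamma> w n"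
  using assms unfolding has_height_def by (elim bexE)

lemma has_height_left:
  assumes "has_height w n" "\<gamma> \<in> GL2_poly" shows "has_height (\<gamma> ** w) n"
  using assms(1) by (rule has_heightE) (rule has_heightI[OF GL2_poly_mult[OF assms(2)] represents_left])

lemma has_height_right:
  assumes "has_height w n" "k \<in> GL2_int" "z \<noteq> 0" shows "has_height (w ** k ** mat z) n"
  using assms(1) by (rule has_heightE) (rule has_heightI[OF _ represents_mult[OF _ assms(2,3)]])

lemma has_height_std: "has_height (mat2 (tt ^ n) 0 0 1) n"
proof (rule has_heightI)
  show "mat 1 \<in> GL2_poly" by (rule GL2_polyI) (auto simp: mat_mat2 mats_over_mat2)
  show "represents (mat 1) (mat2 (tt ^ n) 0 0 1) n" using represents_base[of "mat 1" n] by simp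
qed

lemma GL2_poly_unipotent: "x \<in> poly_ring \<Longrightarrow> mat2 1 x 0 1 \<in> GL2_poly"
  by (rule GL2_polyI) (auto simp: mats_over_mat2)

text \<open>The translation by the polynomial \<open>c t\<^bsup>n + 1\<^esup>\<close> moves all these neighbours to one vertex, the
  predecessor on the standard ray.\<close>
lemma has_height_nbr_std: "has_height (mat2 (tt ^ Suc n) 0 0 1 ** nbr (Some c)) n"
proof -
  have *: "mat2 (tt ^ Suc n) 0 0 1 ** nbr (Some c) = mat2 1 (tt ^ Suc n * fls_const c) 0 1 ** mat2 (tt ^ n) 0 0 1"
    by (simp add: nbr_def algebra_simps)
  have "tt ^ Suc n * fls_const c \<in> poly_ring" by (rule poly_ring_mult) (rule poly_ring_closed)+
  then show ?thesis unfolding * by (intro has_height_left has_height_std GL2_poly_unipotent)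
qed

text \<open>At height \<open>0\<close> the remaining neighbours are moved onto the standard ray by the Weyl element, so the
  height increases in every direction.\<close>
lemma has_height_nbr_zero_std: "has_height (nbr i) 1"
proof (cases i)
  case None then show ?thesis using has_height_std[of 1] by (simp add: nbr_def)
next
  case (Some c)
  have W: "mat2 0 1 1 0 \<in> GL2_int" "mat2 0 1 1 0 \<in> GL2_poly"
    by (auto simp: GL2_int_mat2 mats_over_mat2 intro!: GL2_polyI)
  have *: "nbr i = mat2 1 (fls_const c) 0 1 ** (mat2 0 1 1 0 ** (mat2 (tt ^ 1) 0 0 1 ** mat2 0 1 1 0 ** mat fls_X))"
    by (simp add: nbr_def Some mat_mat2)
  show ?thesis unfolding *
    by (intro has_height_left has_height_right has_height_std W GL2_poly_unipotent) simp_all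
qed

lemma has_height_nbr_zero:
  assumes "has_height w 0" shows "has_height (w ** nbr i) 1"
proof -
  obtain \<gamma> where \<gamma>: "\<gamma> \<in> GL2_poly" "represents \<gamma> w 0" using assms unfolding has_height_def by (elim bexE)
  obtain \<sigma> where \<sigma>: "bij \<sigma>" "\<forall>i m \<gamma>'. represents \<gamma>' (\<gamma> ** mat2 (tt ^ 0) 0 0 1 ** nbr (\<sigma> i)) m \<longrightarrow> represents \<gamma>' (w ** nbr i) m"
    by (rule represents_nbr_cases[OF \<gamma>(2)])
  have "mat2 (tt ^ 0) 0 0 1 = (mat 1 :: 'a fls^2^2)" by (simp add: mat_mat2)
  then have "has_height (\<gamma> ** mat2 (tt ^ 0) 0 0 1 ** nbr (\<sigma> i)) 1"
    using has_height_left[OF has_height_nbr_zero_std[of "\<sigma> i"] \<gamma>(1)] by simp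
  then show ?thesis by (rule has_heightE) (rule has_heightI, assumption, rule \<sigma>(2)[rule_format])
qed

text \<open>A vertex of positive height has exactly one neighbour further out in the cusp, and this neighbour
  lies on the image of the standard ray under the same \<open>\<gamma>\<close>.\<close>
lemma represents_nbr_Suc:
  fixes w :: "'a::{finite,field} fls^2^2"
  assumes "represents \<gamma> w (Suc n)" "\<gamma> \<in> GL2_poly"
  obtains i0 where "represents \<gamma> (w ** nbr i0) (Suc (Suc n))" "\<And>i. i \<noteq> i0 \<Longrightarrow> has_height (w ** nbr i) n"
proof -
  obtain \<sigma> where \<sigma>: "bij \<sigma>" "\<forall>i m \<gamma>'. represents \<gamma>' (\<gamma> ** mat2 (tt ^ Suc n) 0 0 1 ** nbr (\<sigma> i)) m \<longrightarrow> represents \<gamma>' (w ** nbr i) m"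
    by (rule represents_nbr_cases[OF assms(1)])
  obtain i0 where i0: "None = \<sigma> i0" using bij_is_surj[OF \<sigma>(1)] by (rule surjE)
  show ?thesis
  proof (rule that)
    have "mat2 (tt ^ Suc n) 0 0 1 ** nbr (None :: 'a option) = mat2 (tt ^ Suc (Suc n)) 0 0 1"
      by (simp add: nbr_def mult_ac)
    then have *: "\<gamma> ** mat2 (tt ^ Suc n) 0 0 1 ** nbr (\<sigma> i0) = \<gamma> ** mat2 (tt ^ Suc (Suc n)) 0 0 1"
      unfolding i0[symmetric] by (simp only: flip: matrix_mul_assoc)
    show "represents \<gamma> (w ** nbr i0) (Suc (Suc n))"
      by (rule \<sigma>(2)[rule_format]) (simp only: * represents_base)
  next
    fix i assume "i \<noteq> i0"
    then have "\<sigma> i \<noteq> None" using bij_is_inj[OF \<sigma>(1)] by (simp add: inj_eq i0)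
    then obtain c where c: "\<sigma> i = Some c" by (cases "\<sigma> i") auto
    have "has_height (\<gamma> ** (mat2 (tt ^ Suc n) 0 0 1 ** nbr (\<sigma> i))) n"
      unfolding c by (rule has_height_left[OF has_height_nbr_std assms(2)])
    then have "has_height (\<gamma> ** mat2 (tt ^ Suc n) 0 0 1 ** nbr (\<sigma> i)) n"
      by (simp only: matrix_mul_assoc)
    then show "has_height (w ** nbr i) n"
      by (rule has_heightE) (rule has_heightI, assumption, rule \<sigma>(2)[rule_format])
  qed
qed


section \<open>Existence and uniqueness of the height\<close>

lemma int_ring_subdegree: "x \<in> int_ring \<Longrightarrow> 0 \<le> fls_subdegree x"
  by (simp add: int_ring_iff)

text \<open>Comparing determinants gives the valuation of \<open>z\<close>; comparing first columns then gives
  a contradiction unless \<open>m = n\<close>, because entries of \<open>\<gamma>\<close> are polynomials and entries of \<open>k\<close>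
  are integral.\<close>
lemma height_le_aux:
  assumes "\<gamma> \<in> GL2_poly" "k \<in> GL2_int" "z \<noteq> 0" "n \<le> m"
    and eq: "\<gamma> ** mat2 (tt ^ m) 0 0 1 = mat2 (tt ^ n) 0 0 1 ** k ** mat z"
  shows "m = n"
proof -
  obtain p q r s where g: "\<gamma> = mat2 p q r s" by (rule mat2_cases)
  obtain a b c d where k: "k = mat2 a b c d" by (rule mat2_cases)
  note int = GL2_int_D[OF assms(2)[unfolded k]]
  have poly: "p \<in> poly_ring" "r \<in> poly_ring" using assms(1) by (auto simp: g GL2_poly_def mats_over_mat2)
  have e1: "p * tt ^ m = tt ^ n * (a * z)" and e2: "r * tt ^ m = c * z"
    using eq by (auto simp: g k mat_mat2)
  have "det (\<gamma> ** mat2 (tt ^ m) 0 0 1) = det (mat2 (tt ^ n) 0 0 1 ** k ** mat z)"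
    using eq by (rule arg_cong)
  then have "det \<gamma> * tt ^ m = tt ^ n * det k * (z * z)"
    unfolding det_mul by (simp add: mat_mat2)
  moreover have "det k \<noteq> 0" "fls_subdegree (det k) = 0" using assms(2) by (auto simp: GL2_int_def)
  ultimately have "fls_subdegree (det \<gamma> * tt ^ m) = fls_subdegree (tt ^ n * det k * (z * z))" by (simp only:)
  then have val: "- int m = - int n + 2 * fls_subdegree z"
    using GL2_poly_det[OF assms(1)] \<open>det k \<noteq> 0\<close> \<open>fls_subdegree (det k) = 0\<close> assms(3)
    by simp
  have vz: "fls_subdegree z \<le> 0" using val assms(4) by linarith
  show ?thesis
  proof (cases "r = 0")
    case True
    then have "p \<noteq> 0" using GL2_poly_det(1)[OF assms(1)] by (auto simp: g)
    then have "a \<noteq> 0" using e1 by auto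
    then have "fls_subdegree p - int m = - int n + (fls_subdegree a + fls_subdegree z)"
      using arg_cong[OF e1, of fls_subdegree] \<open>p \<noteq> 0\<close> assms(3) by simp
    then show ?thesis using poly_ring_subdegree[OF poly(1)] int_ring_subdegree[OF int(1)] val vz by linarith
  next
    case False
    then have "c \<noteq> 0" using e2 by auto
    then have "fls_subdegree r - int m = fls_subdegree c + fls_subdegree z"
      using arg_cong[OF e2, of fls_subdegree] False assms(3) by auto
    then have "- int m \<ge> fls_subdegree z" 
      using poly_ring_subdegree[OF poly(2)] int_ring_subdegree[OF int(3)] by linarith
    then show ?thesis using val by linarith
  qed
qed

lemma has_height_unique_le:
  assumes "has_height w n" "has_height w m" "n \<le> m" shows "m = n"
proof -
  obtain \<gamma> where \<gamma>: "\<gamma> \<in> GL2_poly" "represents \<gamma> w n" using assms(1) by (rule has_heightE)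
  obtain \<gamma>' where \<gamma>': "\<gamma>' \<in> GL2_poly" "represents \<gamma>' w m" using assms(2) by (rule has_heightE)
  obtain k z where k: "k \<in> GL2_int" "z \<noteq> 0" "w = \<gamma> ** mat2 (tt ^ n) 0 0 1 ** k ** mat z"
    using \<gamma>(2) by (rule representsE)
  obtain l y where l: "l \<in> GL2_int" "y \<noteq> 0" "w = \<gamma>' ** mat2 (tt ^ m) 0 0 1 ** l ** mat y"
    using \<gamma>'(2) by (rule representsE)
  obtain \<delta> where \<delta>: "\<delta> \<in> GL2_poly" "\<delta> ** \<gamma> = mat 1" using \<gamma>(1) by (rule GL2_poly_inverse)
  obtain l' where l': "l' \<in> GL2_int" "l ** l' = mat 1" using l(1) by (rule GL2_int_inverse)
  have i: "y * inverse y = 1" using l(2) by simp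
  have "\<delta> ** \<gamma>' ** mat2 (tt ^ m) 0 0 1 = \<delta> ** \<gamma>' ** mat2 (tt ^ m) 0 0 1 ** (l ** l') ** mat (y * inverse y)"
    unfolding l'(2) i by simp
  also have "\<dots> = \<delta> ** (\<gamma>' ** mat2 (tt ^ m) 0 0 1 ** l ** mat y) ** l' ** mat (inverse y)"
    by (simp only: mat_shift[of _ y l'] mat_mat matrix_mul_assoc)
  also have "\<dots> = \<delta> ** (\<gamma> ** mat2 (tt ^ n) 0 0 1 ** k ** mat z) ** l' ** mat (inverse y)"
    by (simp only: flip: l(3) k(3))
  also have "\<dots> = (\<delta> ** \<gamma>) ** mat2 (tt ^ n) 0 0 1 ** (k ** l') ** mat (z * inverse y)"
    by (simp only: mat_shift[of _ z l'] mat_mat matrix_mul_assoc)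
  finally have eq: "(\<delta> ** \<gamma>') ** mat2 (tt ^ m) 0 0 1 = mat2 (tt ^ n) 0 0 1 ** (k ** l') ** mat (z * inverse y)"
    by (simp only: \<delta>(2) matrix_mul_lid)
  show ?thesis
    by (rule height_le_aux[OF GL2_poly_mult[OF \<delta>(1) \<gamma>'(1)] GL2_int_mult[OF k(1) l'(1)] _ assms(3) eq])
       (use k(2) l(2) in simp)
qed

lemma has_height_unique: "has_height w n \<Longrightarrow> has_height w m \<Longrightarrow> n = m"
  using has_height_unique_le[of w n m] has_height_unique_le[of w m n] by linarith

lemma has_height_nbr_ex:
  assumes "has_height w n" shows "\<exists>m. has_height (w ** nbr i) m"
proof (cases n)
  case 0
  then show ?thesis using has_height_nbr_zero assms by blast
next
  case (Suc n')
  obtain \<gamma> where \<gamma>: "\<gamma> \<in> GL2_poly" "represents \<gamma> w n" using assms by (rule has_heightE)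
  obtain i0 where i0: "represents \<gamma> (w ** nbr i0) (Suc (Suc n'))" "\<And>i. i \<noteq> i0 \<Longrightarrow> has_height (w ** nbr i) n'"
    using represents_nbr_Suc[OF \<gamma>(2)[unfolded Suc] \<gamma>(1)] by metis
  show ?thesis
    using i0(2)[of i] has_heightI[OF \<gamma>(1) i0(1)] by (cases "i = i0") auto
qed

text \<open>After enlarging the first entry by a power of \<open>t\<close> the matrix represents a vertex of the standard
  ray.  The way back consists of steps to neighbours, which preserve the existence of a height.\<close>
lemma upper_triangular_has_height:
  assumes "x \<noteq> 0" shows "\<exists>n. has_height (mat2 x y 0 1) n"
proof -
  \<comment> \<open>After multiplication by this power of \<open>t\<close> the first entry dominates both \<open>1\<close> and \<open>y\<close>.\<close>
  define m where "m = nat (max (fls_subdegree x) (fls_subdegree x - fls_subdegree y))"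
  have m: "fls_subdegree x \<le> int m" "fls_subdegree x - fls_subdegree y \<le> int m"
    unfolding m_def by linarith+
  have "\<exists>n. has_height (mat2 (x * tt ^ m * fls_X ^ i) y 0 1) n" for i
  proof (induction i)
    case 0
    define j where "j = nat (int m - fls_subdegree x)"
    let ?k = "mat2 (x * tt ^ m * fls_X ^ j) (y * fls_X ^ j) 0 1"
    have "fls_subdegree (x * tt ^ m * fls_X ^ j) = 0"
      using assms m(1) by (simp add: j_def)
    moreover have "0 \<le> fls_subdegree (y * fls_X ^ j)"
      by (cases "y = 0") (use m in \<open>auto simp: j_def\<close>)
    ultimately have k: "?k \<in> GL2_int" using assms by (simp add: GL2_int_mat2 int_ring_iff)
    have "tt ^ j * fls_X ^ j = (1 :: 'a fls)" by (simp add: power_mult_distrib[symmetric])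
    then have "tt ^ j * (u * fls_X ^ j) = u" for u :: "'a fls" by (metis mult.left_commute mult_1_right)
    then have "mat2 (x * tt ^ m) y 0 1 = mat2 (tt ^ j) 0 0 1 ** ?k ** mat 1"
      by simp
    then have "has_height (mat2 (x * tt ^ m) y 0 1) j"
      using has_height_right[OF has_height_std k, of 1 j] by (simp only: one_neq_zero not_False_eq_True)
    then show ?case by auto
  next
    case (Suc i)
    then obtain n where n: "has_height (mat2 (x * tt ^ m * fls_X ^ i) y 0 1) n" ..
    have "mat2 (x * tt ^ m * fls_X ^ i) y 0 1 ** nbr (Some 0) = mat2 (x * tt ^ m * fls_X ^ Suc i) y 0 1"
      by (simp add: nbr_def mult_ac)
    then show ?case using has_height_nbr_ex[OF n, of "Some 0"] by simp
  qed
  from this[of m] show ?thesis by (simp add: mult.assoc power_mult_distrib[symmetric])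
qed

text \<open>The Iwasawa decomposition, obtained by a column operation with the larger of the two lower
  entries, reduces the claim to upper triangular matrices.\<close>
lemma has_height_ex:
  assumes "det w \<noteq> 0" shows "\<exists>n. has_height w n"
proof -
  obtain p q r s where w: "w = mat2 p q r s" by (rule mat2_cases)
  have D: "p * s - q * r \<noteq> 0" using assms by (simp add: w)
  have "\<exists>x y k z. x \<noteq> 0 \<and> z \<noteq> 0 \<and> k \<in> GL2_int \<and> w = mat2 x y 0 1 ** k ** mat z"
  proof (cases "s \<noteq> 0 \<and> r / s \<in> int_ring")
    case True
    have "w = mat2 ((p - q * r / s) / s) (q / s) 0 1 ** mat2 1 0 (r / s) 1 ** mat s"
      using True by (simp add: w mat_mat2 field_simps)
    moreover have "(p - q * r / s) / s \<noteq> 0" using True D by (simp add: field_simps)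
    moreover have "mat2 1 0 (r / s) 1 \<in> GL2_int" using True by (simp add: GL2_int_mat2)
    ultimately show ?thesis using True by blast
  next
    case False
    then have r: "r \<noteq> 0" using D by auto
    have i: "s / r \<in> int_ring"
    proof (cases "s = 0")
      case s: False
      then have "r / s \<notin> int_ring" using False by blast
      then show ?thesis using s r by (simp add: int_ring_iff fls_divide_subdegree)
    qed simp
    have "w = mat2 ((q - p * s / r) / r) (p / r) 0 1 ** mat2 0 1 1 (s / r) ** mat r"
      using r by (simp add: w mat_mat2 field_simps)
    moreover have "(q - p * s / r) / r \<noteq> 0" using r D by (simp add: field_simps)
    moreover have "mat2 0 1 1 (s / r) \<in> GL2_int" using i by (simp add: GL2_int_mat2)
    ultimately show ?thesis using r by blast
  qed
  then obtain x y k z where *: "x \<noteq> 0" "z \<noteq> 0" "k \<in> GL2_int" "w = mat2 x y 0 1 ** k ** mat z" by auto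
  obtain n where "has_height (mat2 x y 0 1) n" using upper_triangular_has_height[OF *(1)] ..
  then show ?thesis unfolding *(4) using has_height_right * by blast
qed

lemma smult_mat_vec: "c *s v = mat c *v (v :: 'b::comm_semiring_1^2)"
  by (simp add: vec_eq_iff forall_2 mat_mat2 mat2_vec)

lemma O_span_pair:
  assumes "u \<noteq> v" shows "O_span {u, v} = {x *s u + y *s v | x y. x \<in> int_ring \<and> y \<in> int_ring}"
  (is "?L = ?R")
proof
  show "?L \<subseteq> ?R" using assms unfolding O_span_def by (auto simp: Pi_iff)
  show "?R \<subseteq> ?L"
  proof
    fix w assume "w \<in> ?R"
    then obtain x y where "x \<in> int_ring" "y \<in> int_ring" "w = x *s u + y *s v" by blast
    then show "w \<in> ?L" using assms unfolding O_span_def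
      by (intro CollectI exI[of _ "\<lambda>t. if t = u then x else y"]) (auto)
  qed
qed

text \<open>The definition of the homothety relation asks that both members are lattices; this makes the
  homothety class of the standard lattice consist of all its nonzero multiples.\<close>
lemma scaled_std_lattice:
  assumes "c \<noteq> 0" shows "(*s) c ` std_lattice \<in> lattices"
proof -
  let ?u = "vector [c, 0] :: 'a fls^2" and ?v = "vector [0, c] :: 'a fls^2"
  have uv: "?u \<noteq> ?v" using assms by (simp add: vec_eq_iff forall_2)
  have dec: "w \<in> O_span {?u, ?v} \<longleftrightarrow> (\<exists>x\<in>int_ring. \<exists>y\<in>int_ring. w$1 = x * c \<and> w$2 = y * c)"
    for w :: "'a fls^2"
    unfolding O_span_pair[OF uv] by (auto simp: vec_eq_iff forall_2)
  have "(*s) c ` std_lattice = O_span {?u, ?v}"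
  proof (intro equalityI subsetI)
    fix w :: "'a fls^2" assume "w \<in> (*s) c ` std_lattice"
    then obtain v where v: "w = c *s v" "v \<in> std_lattice" by blast
    then show "w \<in> O_span {?u, ?v}" unfolding dec
      by (intro bexI[of _ "v$1"] bexI[of _ "v$2"]) (simp_all add: std_lattice_def)
  next
    fix w assume "w \<in> O_span {?u, ?v}"
    then obtain x y where xy: "x \<in> int_ring" "y \<in> int_ring" "w$1 = x * c" "w$2 = y * c"
      unfolding dec by blast
    then have "w = c *s vector [x, y]" by (simp add: vec_eq_iff forall_2)
    moreover have "vector [x, y] \<in> std_lattice" using xy by (simp add: std_lattice_def forall_2)
    ultimately show "w \<in> (*s) c ` std_lattice" by blast
  qed
  moreover have "vec.span ((*s) c ` std_lattice) = UNIV"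
  proof -
    have "w \<in> vec.span ((*s) c ` std_lattice)" for w :: "'a fls^2"
    proof -
      have e: "vector [1, 0] \<in> (std_lattice :: ('a fls^2) set)" "vector [0, 1] \<in> (std_lattice :: ('a fls^2) set)"
        by (simp_all add: std_lattice_def forall_2)
      have "?u = c *s vector [1, 0]" "?v = c *s vector [0, 1]" by (simp_all add: vec_eq_iff forall_2)
      then have uvs: "?u \<in> (*s) c ` std_lattice" "?v \<in> (*s) c ` std_lattice" using e by (simp_all only: imageI)
      have "w = (w$1 / c) *s ?u + (w$2 / c) *s ?v" using assms by (simp add: vec_eq_iff forall_2)
      then show ?thesis using uvs
        by (metis vec.span_add vec.span_base vec.span_scale)
    qed
    then show ?thesis by blast
  qed
  ultimately show ?thesis unfolding lattices_def by (auto intro!: exI[of _ "{?u, ?v}"])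
qed

lemma std_vertex: "homothety `` {std_lattice} = {(*s) c ` std_lattice | c. c \<noteq> 0}"
proof -
  have "(*s) (1 :: 'a fls) ` std_lattice = (std_lattice :: ('a fls^2) set)" by simp
  then have "(std_lattice :: ('a fls^2) set) \<in> lattices" using scaled_std_lattice[of 1] by simp
  then show ?thesis unfolding homothety_def using scaled_std_lattice by auto
qed

lemma image_mat_mult: "(*v) A ` (*v) B ` L = (*v) (A ** B) ` L" for A B :: "'b::comm_semiring_1^2^2"
  by (simp add: image_image matrix_vector_mul_assoc)

lemma vertex_act_std:
  "vertex_act A (homothety `` {std_lattice}) = {(*v) (A ** mat c) ` std_lattice | c. c \<noteq> 0}"
  unfolding vertex_act_def std_vertex smult_mat_vec setcompr_eq_image image_image[of "(`) ((*v) A)"]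
    image_mat_mult ..

lemma vertex_act_vv:
  "vertex_act A (vv n) = {(*v) (A ** mat2 (tt ^ n) 0 0 1 ** mat c) ` std_lattice | c. c \<noteq> 0}"
  unfolding vv_def mat2_def[symmetric] vertex_act_std
  unfolding vertex_act_def setcompr_eq_image image_image[of "(`) ((*v) A)"] image_mat_mult matrix_mul_assoc ..

lemma GL2_int_std_lattice:
  assumes "k \<in> GL2_int" shows "(*v) k ` std_lattice = std_lattice"
proof -
  have sub: "(*v) l ` std_lattice \<subseteq> std_lattice" if "l \<in> GL2_int" for l
    using that by (cases l rule: mat2_cases) (auto simp: GL2_int_mat2 mat2_vec std_lattice_def forall_2)
  obtain l where l: "l \<in> GL2_int" "k ** l = mat 1" using assms by (rule GL2_int_inverse)
  have "std_lattice = (*v) k ` (*v) l ` std_lattice" by (simp add: image_mat_mult l)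
  then show ?thesis using sub[OF l(1)] sub[OF assms] by blast
qed

text \<open>The images of the two unit vectors show that \<open>k\<close> and its inverse are integral, so the
  determinants have valuation \<open>0\<close>.\<close>
lemma std_lattice_stabilizer:
  assumes "(*v) k ` std_lattice = std_lattice" "k ** l = mat 1" "l ** k = mat 1"
  shows "k \<in> GL2_int"
proof -
  have int: "m \<in> mats_over int_ring" if "(*v) m ` std_lattice \<subseteq> std_lattice" for m :: "'a fls^2^2"
  proof -
    obtain a b c d where m: "m = mat2 a b c d" by (rule mat2_cases)
    have "vector [1, 0] \<in> (std_lattice :: ('a fls^2) set)" "vector [0, 1] \<in> (std_lattice :: ('a fls^2) set)"
      by (auto simp: std_lattice_def forall_2)
    then have "m *v vector [1, 0] \<in> std_lattice" "m *v vector [0, 1] \<in> std_lattice" using that by blast+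
    then show ?thesis by (simp add: m mat2_vec std_lattice_def forall_2 mats_over_mat2)
  qed
  have "(*v) l ` std_lattice = (*v) l ` (*v) k ` std_lattice" using assms(1) by simp
  also have "\<dots> = std_lattice" by (simp add: image_mat_mult assms(3))
  finally have kl: "k \<in> mats_over int_ring" "l \<in> mats_over int_ring" using int assms(1) by blast+
  have dint: "0 \<le> fls_subdegree (det m)" if "m \<in> mats_over int_ring" for m :: "'a fls^2^2"
    using that by (cases m rule: mat2_cases) (auto simp: mats_over_mat2 simp flip: int_ring_iff)
  have d: "det k * det l = 1" using assms(2) by (metis det_mul det_I)
  then have nz: "det k \<noteq> 0" "det l \<noteq> 0" by auto
  then have "fls_subdegree (det k) + fls_subdegree (det l) = 0"
    using arg_cong[OF d, of fls_subdegree] by simp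
  then have "fls_subdegree (det k) = 0" using dint[OF kl(1)] dint[OF kl(2)] by linarith
  then show ?thesis using nz kl by (simp add: GL2_int_def)
qed

lemma invertible2:
  assumes "det (w::'a::{finite,field} fls^2^2) \<noteq> 0" obtains w' where "w ** w' = mat 1" "w' ** w = mat 1"
  using assms unfolding invertible_det_nz[symmetric] invertible_def by blast

lemma vertex_act_eq_iff_represents:
  assumes "det w \<noteq> 0" "\<gamma> \<in> GL2_poly"
  shows "vertex_act w (vv 0) = vertex_act \<gamma> (vv n) \<longleftrightarrow> represents \<gamma> w n"
proof
  have one: "mat2 (tt ^ 0) 0 0 1 = (mat 1 :: 'a fls^2^2)" by (simp add: mat_mat2)
  {
    assume "represents \<gamma> w n"
    then obtain k z where k: "k \<in> GL2_int" "z \<noteq> 0" "w = \<gamma> ** mat2 (tt ^ n) 0 0 1 ** k ** mat z"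
      by (rule representsE)
    have *: "(*v) (w ** mat c) ` std_lattice = (*v) (\<gamma> ** mat2 (tt ^ n) 0 0 1 ** mat (z * c)) ` std_lattice" for c
    proof -
      have "w ** mat c = \<gamma> ** mat2 (tt ^ n) 0 0 1 ** mat (z * c) ** k"
        by (simp only: k(3) mat_mat mat_shift[of _ "z * c" k])
      then show ?thesis using GL2_int_std_lattice[OF k(1)] by (metis image_mat_mult)
    qed
    have scale: "{f (z * c) |c. c \<noteq> 0} = {f c |c. c \<noteq> 0}" for f :: "'a fls \<Rightarrow> ('a fls^2) set"
    proof (intro equalityI subsetI)
      fix S assume "S \<in> {f (z * c) |c. c \<noteq> 0}"
      then show "S \<in> {f c |c. c \<noteq> 0}" using k(2) by force
    next
      fix S assume "S \<in> {f c |c. c \<noteq> 0}"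
      then obtain c where "S = f c" "c \<noteq> 0" by blast
      then show "S \<in> {f (z * c) |c. c \<noteq> 0}"
        using k(2) by (intro CollectI exI[of _ "c / z"]) simp
    qed
    show "vertex_act w (vv 0) = vertex_act \<gamma> (vv n)"
      unfolding vertex_act_vv one matrix_mul_rid * by (rule scale)
  }
  {
    assume eq: "vertex_act w (vv 0) = vertex_act \<gamma> (vv n)"
    have "(*v) (w ** mat 1) ` std_lattice \<in> vertex_act w (vv 0)"
      unfolding vertex_act_vv one matrix_mul_rid[of w] by (intro CollectI exI[of _ 1]) simp
    then have "(*v) (w ** mat 1) ` std_lattice \<in> vertex_act \<gamma> (vv n)" by (simp only: eq)
    then obtain c where c: "c \<noteq> 0" "(*v) w ` std_lattice = (*v) (\<gamma> ** mat2 (tt ^ n) 0 0 1 ** mat c) ` std_lattice"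
      unfolding vertex_act_vv by auto
    define M where "M = \<gamma> ** mat2 (tt ^ n) 0 0 1 ** mat c"
    have "det M \<noteq> 0" using GL2_poly_det[OF assms(2)] c by (simp add: M_def det_mul mat_mat2)
    then obtain M' where M': "M ** M' = mat 1" "M' ** M = mat 1" by (rule invertible2)
    obtain w' where w': "w ** w' = mat 1" "w' ** w = mat 1" using assms(1) by (rule invertible2)
    have "(*v) (M' ** w) ` std_lattice = (*v) M' ` (*v) w ` std_lattice" by (simp add: image_mat_mult)
    also have "\<dots> = (*v) M' ` (*v) M ` std_lattice" using c by (simp add: M_def)
    also have "\<dots> = std_lattice" by (simp add: image_mat_mult M')
    finally have st: "(*v) (M' ** w) ` std_lattice = std_lattice" .
    have "(M' ** w) ** (w' ** M) = M' ** (w ** w') ** M" by (simp only: matrix_mul_assoc)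
    then have 1: "(M' ** w) ** (w' ** M) = mat 1" by (simp add: M' w')
    have "(w' ** M) ** (M' ** w) = w' ** (M ** M') ** w" by (simp only: matrix_mul_assoc)
    then have 2: "(w' ** M) ** (M' ** w) = mat 1" by (simp add: M' w')
    have k: "M' ** w \<in> GL2_int" using std_lattice_stabilizer[OF st 1 2] .
    have "w = M ** (M' ** w)" by (simp add: matrix_mul_assoc M')
    also have "\<dots> = \<gamma> ** mat2 (tt ^ n) 0 0 1 ** (M' ** w) ** mat c"
      by (simp only: M_def mat_shift[of _ c "M' ** w"])
    finally show "represents \<gamma> w n" by (rule representsI[OF k c(1)])
  }
qed

definition ht :: "'a::{finite,field} fls^2^2 \<Rightarrow> nat" where
  "ht w = height (vertex_act w (vv 0))"

lemma ht_eq: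
  assumes "has_height w n" "det w \<noteq> 0" shows "ht w = n"
proof -
  have "(\<exists>\<gamma>\<in>GL2_poly. vertex_act w (vv 0) = vertex_act \<gamma> (vv m)) \<longleftrightarrow> has_height w m" for m
    using vertex_act_eq_iff_represents[OF assms(2)] unfolding has_height_def by auto
  then show ?thesis unfolding ht_def height_def
    using assms(1) has_height_unique by (intro the_equality) auto
qed

lemma has_height_ht: "det w \<noteq> 0 \<Longrightarrow> has_height w (ht w)"
  using has_height_ex ht_eq by metis


section \<open>Counting descendants by height\<close>

lemma det_nbr: "det (nbr i) \<noteq> 0"
  by (cases i) (auto simp: nbr_def)

lemma det_mult_nbr: "det w \<noteq> 0 \<Longrightarrow> det (w ** nbr i) \<noteq> 0"
  by (simp add: det_mul det_nbr)

lemma ht_nbr_zero: "det w \<noteq> 0 \<Longrightarrow> ht w = 0 \<Longrightarrow> ht (w ** nbr i) = 1"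
  using has_height_nbr_zero has_height_ht ht_eq det_mult_nbr by metis

lemma ht_nbr_Suc:
  fixes w :: "'a::{finite,field} fls^2^2"
  assumes "det w \<noteq> 0" "ht w = Suc n"
  obtains i0 where "ht (w ** nbr i0) = Suc (Suc n)" "\<forall>i. i \<noteq> i0 \<longrightarrow> ht (w ** nbr i) = n"
proof -
  obtain \<gamma> where \<gamma>: "\<gamma> \<in> GL2_poly" "represents \<gamma> w (Suc n)"
    using has_height_ht[OF assms(1)] unfolding assms(2) by (rule has_heightE)
  obtain i0 where i0: "represents \<gamma> (w ** nbr i0) (Suc (Suc n))" "\<And>i. i \<noteq> i0 \<Longrightarrow> has_height (w ** nbr i) n"
    using represents_nbr_Suc[OF \<gamma>(2) \<gamma>(1)] by metis
  note eq = ht_eq[OF _ det_mult_nbr[OF assms(1)]]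
  show ?thesis
    by (rule that[OF eq[OF has_heightI[OF \<gamma>(1) i0(1)]]]) (use eq[OF i0(2)] in blast)
qed

lemma ht_right:
  assumes "det w \<noteq> 0" "k \<in> GL2_int" "z \<noteq> 0" shows "ht (w ** k ** mat z) = ht w"
proof (rule ht_eq)
  show "has_height (w ** k ** mat z) (ht w)" using has_height_right[OF has_height_ht] assms by blast
  show "det (w ** k ** mat z) \<noteq> 0" using assms by (auto simp: det_mul GL2_int_def mat_mat2)
qed

lemma ht_left:
  assumes "det w \<noteq> 0" "\<gamma> \<in> GL2_poly" shows "ht (\<gamma> ** w) = ht w"
proof (rule ht_eq)
  show "has_height (\<gamma> ** w) (ht w)" using has_height_left[OF has_height_ht] assms by blast
  show "det (\<gamma> ** w) \<noteq> 0" using assms GL2_poly_det by (auto simp: det_mul)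
qed

lemma ht_int: "det w \<noteq> 0 \<Longrightarrow> k \<in> GL2_int \<Longrightarrow> ht (w ** k) = ht w"
  using ht_right[of w k 1] by simp

lemma ht_scale: "det w \<noteq> 0 \<Longrightarrow> z \<noteq> 0 \<Longrightarrow> ht (w ** mat z) = ht w"
  using ht_right[of w "mat 1" z] by simp

text \<open>The end \<open>w\<infinity>\<close> is not changed by a step away from it, so going back towards this end undoes the
  step.\<close>
lemma ht_child_parent: "det w \<noteq> 0 \<Longrightarrow> ht (w ** nbr (Some c) ** nbr None) = ht w"
proof -
  assume "det w \<noteq> 0"
  have "nbr (Some c) ** nbr None = mat2 1 (fls_const c) 0 1" by (simp add: nbr_def)
  moreover have "mat2 1 (fls_const c) 0 1 \<in> GL2_int" by (simp add: GL2_int_mat2)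
  ultimately show ?thesis using ht_int[OF \<open>det w \<noteq> 0\<close>] by (simp add: matrix_mul_assoc[symmetric])
qed

text \<open>In \<open>\<gamma> diag(t\<^sup>n, 1) k z\<close> the outer matrices have determinants of valuation \<open>0\<close>, and the scalar contributes
  an even number.\<close>
lemma has_height_parity:
  assumes "has_height w n" shows "even (int n + fls_subdegree (det w))"
proof -
  obtain \<gamma> where \<gamma>: "\<gamma> \<in> GL2_poly" "represents \<gamma> w n" using assms by (rule has_heightE)
  obtain k z where k: "k \<in> GL2_int" "z \<noteq> 0" "w = \<gamma> ** mat2 (tt ^ n) 0 0 1 ** k ** mat z"
    using \<gamma>(2) by (rule representsE)
  have "det w = det \<gamma> * tt ^ n * det k * (z * z)" by (simp add: k(3) det_mul mat_mat2)
  then have "fls_subdegree (det w) = - int n + 2 * fls_subdegree z"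
    using GL2_poly_det[OF \<gamma>(1)] k by (simp add: GL2_int_def)
  then show ?thesis by simp
qed

lemma ht_even: "det w = 1 \<Longrightarrow> even (ht w)"
  using has_height_parity[OF has_height_ht[of w]] by simp

lemma ht_nbr_up_or_down:
  assumes "det w \<noteq> 0"
  shows "ht (w ** nbr i) = Suc (ht w) \<or> Suc (ht (w ** nbr i)) = ht w"
proof (cases "ht w")
  case 0 then show ?thesis using ht_nbr_zero[OF assms] by simp
next
  case (Suc n)
  show ?thesis using ht_nbr_Suc[OF assms Suc] Suc by metis
qed

text \<open>The number of vertices of height at least \<open>J\<close> among those that are reached from \<open>w\<close> by \<open>N\<close> steps
  away from the end \<open>w\<infinity>\<close>.  Counting heights at least \<open>J\<close> rather than equal to \<open>J\<close> gives simpler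
  formulas.\<close>
primrec high_descendants :: "nat \<Rightarrow> nat \<Rightarrow> 'a::{finite,field} fls^2^2 \<Rightarrow> nat" where
  "high_descendants J 0 w = (if J \<le> ht w then 1 else 0)"
| "high_descendants J (Suc N) w = (\<Sum>c\<in>UNIV. high_descendants J N (w ** nbr (Some c)))"

lemma high_descendants_full:
  fixes w :: "'a::{finite,field} fls^2^2"
  shows "det w \<noteq> 0 \<Longrightarrow> N + J \<le> ht w \<Longrightarrow> high_descendants J N w = CARD('a) ^ N"
proof (induction N arbitrary: w)
  case (Suc N)
  have "high_descendants J N (w ** nbr (Some c)) = CARD('a) ^ N" for c
    using Suc.prems ht_nbr_up_or_down[OF Suc.prems(1), of "Some c"]
    by (intro Suc.IH det_mult_nbr) auto
  then show ?case by simp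
qed simp

lemma high_descendants_zero:
  fixes w :: "'a::{finite,field} fls^2^2"
  shows "det w \<noteq> 0 \<Longrightarrow> ht w + N < J \<Longrightarrow> high_descendants J N w = 0"
proof (induction N arbitrary: w)
  case (Suc N)
  have "high_descendants J N (w ** nbr (Some c)) = 0" for c
    using Suc.prems ht_nbr_up_or_down[OF Suc.prems(1), of "Some c"]
    by (intro Suc.IH det_mult_nbr) auto
  then show ?case by simp
qed simp

lemma sum_one_exceptional:
  fixes c0 :: "'a::finite" and a b :: nat
  shows "(\<Sum>c\<in>UNIV. if c = c0 then a else b) = a + (CARD('a) - 1) * b"
  by (simp add: sum.remove[of UNIV c0] card_Diff_singleton)

lemma high_descendants_exceptional_child:
  fixes c0 :: "'a::{finite,field}"
  assumes "\<And>c. high_descendants J N (w ** nbr (Some c)) = (if c = c0 then a else b)"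
  shows "high_descendants J (Suc N) w = a + (CARD('a) - 1) * b"
  using assms by (simp add: sum_one_exceptional)

text \<open>The next step depends on the height of the vertex and on whether its parent, the neighbour
  towards the end, lies higher or lower.  If the parent lies higher, or the height is \<open>0\<close>, all
  children share one height.  If the parent lies lower, one child lies higher and has again a
  lower parent, while the other \<open>q - 1\<close> children begin a descent.  The three claims are proved
  together because each case leads to the others.  The second claim concerns walks that are too
  short to come back up to height \<open>J\<close> after reaching height \<open>0\<close>: such a walk ends at height at
  least \<open>J\<close> if and only if it climbs during its first \<open>N - e\<close> steps, and the other \<open>e\<close> steps are
  then free.\<close>
lemma high_descendants_formula:
  fixes w :: "'a::{finite,field} fls^2^2" and J N :: nat
  defines "q \<equiv> CARD('a)"
  assumes J: "1 \<le> J" and w: "det w \<noteq> 0" and parity: "even (N + ht w + J)"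
  shows "ht w < J + N \<Longrightarrow> ht w = 0 \<or> ht (w ** nbr None) = Suc (ht w) \<Longrightarrow>
           high_descendants J N w = (if ht w + J \<le> N then q ^ (N + 1 - J) else 0)" (is "PROP ?U w N")
    and "Suc (ht (w ** nbr None)) = ht w \<Longrightarrow> N < ht w + J \<Longrightarrow> N + ht w = J + 2 * e \<Longrightarrow> e \<le> N \<Longrightarrow>
           high_descendants J N w = q ^ e" (is "PROP ?D w N e")
    and "Suc (ht (w ** nbr None)) = ht w \<Longrightarrow> ht w + J \<le> N \<Longrightarrow>
           high_descendants J N w = q ^ (N + 1 - J)" (is "PROP ?E w N")
  using w parity
proof (induction N arbitrary: w e)
  case 0
  {
    case 1 then show ?case using J by auto
  next
    case 2 then show ?case by auto
  next
    case 3 then show ?case using J by auto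
  }
next
  case (Suc N)
  note IH = Suc.IH
  have q1: "1 + (q - 1) = q" and q: "q = CARD('a)" unfolding q_def by auto
  {
    case 1
    note det = 1(3)
    note ch = det_mult_nbr[OF det] ht_child_parent[OF det]
    have par: "even (N + Suc (ht w) + J)" using 1 by simp
    show ?case
    proof (cases "ht w")
      case 0
      have h: "ht (w ** nbr (Some c)) = 1" for c using ht_nbr_zero[OF det 0] .
      have "N \<noteq> J" using par 0 by auto
      then consider "Suc N < J" | "Suc N = J" | "1 + J \<le> N" by linarith
      then have "high_descendants J N (w ** nbr (Some c)) = (if J \<le> Suc N then q ^ (N + 1 - J) else 0)" for c
      proof cases
        case 1 then show ?thesis using h high_descendants_zero[OF det_mult_nbr[OF det]] by simp
      next
        case 2
        have "high_descendants J N (w ** nbr (Some c)) = q ^ 0"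
          by (rule IH(2)) (use h ch det par 2 0 in simp_all)
        then show ?thesis using 2 by simp
      next
        case 3
        have "high_descendants J N (w ** nbr (Some c)) = q ^ (N + 1 - J)"
          by (rule IH(3)) (use h ch det par 3 0 in simp_all)
        then show ?thesis using 3 by simp
      qed
      then show ?thesis using 0 by (auto simp: q Suc_diff_le)
    next
      case (Suc n)
      then have up: "ht (w ** nbr None) = Suc (Suc n)" using 1 by auto
      have h: "ht (w ** nbr (Some c)) = n" for c
        using ht_nbr_Suc[OF det Suc] up by (metis n_not_Suc_n option.distinct(1) less_SucI less_irrefl_nat lessI)
      have "high_descendants J N (w ** nbr (Some c)) = (if ht (w ** nbr (Some c)) + J \<le> N then q ^ (N + 1 - J) else 0)" for c
        by (rule IH(1)) (use h ch det par 1(1) Suc in simp_all)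
      then show ?thesis using J Suc h by (auto simp: q Suc_diff_le)
    qed
  next
    case 2
    note det = 2(5)
    note ch = det_mult_nbr[OF det] ht_child_parent[OF det]
    have par: "even (N + Suc (ht w) + J)" using 2 by simp
    show ?case
    proof (cases "e = Suc N")
      case True then show ?thesis using 2 high_descendants_full[of w "Suc N" J] det by (simp add: q)
    next
      case False
      then have e: "e \<le> N" using 2 by simp
      obtain n where n: "ht w = Suc n" using 2 by (metis)
      obtain i0 where i0: "ht (w ** nbr i0) = Suc (Suc n)" "\<forall>i. i \<noteq> i0 \<longrightarrow> ht (w ** nbr i) = n"
        using ht_nbr_Suc[OF det n] .
      have "i0 \<noteq> None" by (rule notI) (use i0(1) 2(1) n in simp)
      then obtain c0 where c0: "i0 = Some c0" by auto
      have "high_descendants J N (w ** nbr (Some c)) = (if c = c0 then q ^ e else 0)" for c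
      proof (cases "c = c0")
        case True
        have "high_descendants J N (w ** nbr (Some c)) = q ^ e"
          by (rule IH(2)) (use i0 ch det par 2 n e c0 True in simp_all)
        then show ?thesis using True by simp
      next
        case False
        then have h: "ht (w ** nbr (Some c)) = n" using i0 c0 by simp
        have "high_descendants J N (w ** nbr (Some c)) = (if ht (w ** nbr (Some c)) + J \<le> N then q ^ (N + 1 - J) else 0)"
          by (rule IH(1)) (use h ch det par 2 n e in simp_all)
        then show ?thesis using h 2 n False by simp
      qed
      then show ?thesis by (simp only: high_descendants_exceptional_child mult_0_right add_0_right)
    qed
  next
    case 3
    note det = 3(3)
    note ch = det_mult_nbr[OF det] ht_child_parent[OF det]
    have par: "even (N + Suc (ht w) + J)" using 3 by simp
    obtain n where n: "ht w = Suc n" using 3 by (metis)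
    obtain i0 where i0: "ht (w ** nbr i0) = Suc (Suc n)" "\<forall>i. i \<noteq> i0 \<longrightarrow> ht (w ** nbr i) = n"
      using ht_nbr_Suc[OF det n] .
    have "i0 \<noteq> None" by (rule notI) (use i0(1) 3(1) n in simp)
    then obtain c0 where c0: "i0 = Some c0" by auto
    have "high_descendants J N (w ** nbr (Some c)) = (if c = c0 then q ^ (N + 1 - J) else q ^ (N + 1 - J))" for c
    proof (cases "c = c0")
      case True
      then have h: "ht (w ** nbr (Some c)) = Suc (Suc n)" using i0 c0 by simp
      consider "Suc (Suc n) + J \<le> N" | "N = n + J" using 3(2) n par
        by (cases "Suc (Suc n) + J \<le> N"; cases "N = Suc n + J") auto
      then have "high_descendants J N (w ** nbr (Some c)) = q ^ (N + 1 - J)"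
      proof cases
        case 1
        show ?thesis by (rule IH(3)) (use h ch det par n 1 in simp_all)
      next
        \<comment> \<open>By parity the walk is just one step too short for the third claim, and the second claim takes
          over with the same value.\<close>
        case 2
        have "high_descendants J N (w ** nbr (Some c)) = q ^ Suc n"
          by (rule IH(2)) (use h ch det par n 2 J in simp_all)
        then show ?thesis using 2 by simp
      qed
      then show ?thesis by simp
    next
      case False
      then have h: "ht (w ** nbr (Some c)) = n" using i0 c0 by simp
      have "high_descendants J N (w ** nbr (Some c)) = (if ht (w ** nbr (Some c)) + J \<le> N then q ^ (N + 1 - J) else 0)"
        by (rule IH(1)) (use h ch det par 3 n J in simp_all)
      then show ?thesis using h 3 n by simp
    qed
    then have "high_descendants J (Suc N) w = q ^ (N + 1 - J) + (q - 1) * q ^ (N + 1 - J)"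
      unfolding q by (rule high_descendants_exceptional_child)
    also have "\<dots> = q * q ^ (N + 1 - J)" using q1 by (metis add_mult_distrib mult_1)
    also have "\<dots> = q ^ (Suc N + 1 - J)" using 3(2) by (simp add: Suc_diff_le)
    finally show ?case .
  }
qed

lemma high_descendants_far:
  fixes w :: "'a::{finite,field} fls^2^2"
  assumes "1 \<le> J" "det w \<noteq> 0" "even (N + ht w + J)" "ht w + J \<le> N"
  shows "high_descendants J N w = CARD('a) ^ (N + 1 - J)"
  using high_descendants_formula(1,3)[OF assms(1-3)] ht_nbr_up_or_down[OF assms(2), of None] assms by auto

lemma sum_option_one_exceptional:
  fixes i0 :: "'a::finite option" and a b :: nat
  shows "(\<Sum>i\<in>UNIV. if i = i0 then a else b) = a + CARD('a) * b"
  by (subst sum_one_exceptional) (simp add: card_UNIV_option)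

text \<open>The averaging operator over the neighbours acts on functions of the height.\<close>
lemma nbr_sum:
  fixes w :: "'a::{finite,field} fls^2^2" and f :: "nat \<Rightarrow> nat"
  assumes "det w \<noteq> 0"
  shows "(\<Sum>i\<in>UNIV. f (ht (w ** nbr i))) =
    (if ht w = 0 then (CARD('a) + 1) * f 1 else f (ht w + 1) + CARD('a) * f (ht w - 1))"
proof (cases "ht w")
  case 0 then show ?thesis using ht_nbr_zero[OF assms] by (simp add: card_UNIV_option)
next
  case (Suc n)
  obtain i0 where i0: "ht (w ** nbr i0) = Suc (Suc n)" "\<forall>i. i \<noteq> i0 \<longrightarrow> ht (w ** nbr i) = n"
    using ht_nbr_Suc[OF assms Suc] .
  then have "f (ht (w ** nbr i)) = (if i = i0 then f (Suc (Suc n)) else f n)" for i by simp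
  then show ?thesis using Suc by (simp only: sum_option_one_exceptional) simp
qed

text \<open>Only the heights \<open>J - 2\<close> and \<open>J\<close> exchange mass across the threshold \<open>J\<close> in two steps, so after
  integration against a stationary law this becomes an equality of the two flows.\<close>
lemma two_step_sum:
  fixes w :: "'a::{finite,field} fls^2^2"
  defines "q \<equiv> CARD('a)"
  assumes w: "det w \<noteq> 0" and even: "even (ht w)" "even J" and J: "2 \<le> J"
  shows "(\<Sum>i\<in>UNIV. \<Sum>j\<in>UNIV. of_bool (J \<le> ht (w ** nbr i ** nbr j))) + q\<^sup>2 * of_bool (ht w = J) =
    (q + 1)\<^sup>2 * of_bool (J \<le> ht w) + (if J = 2 then q + 1 else 1) * of_bool (ht w + 2 = J)"
proof -
  define F where "F m = (if m = 0 then (q + 1) * of_bool (J \<le> 1) else of_bool (J \<le> m + 1) + q * of_bool (J \<le> m - 1))" for m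
  have "(\<Sum>i\<in>UNIV. \<Sum>j\<in>UNIV. of_bool (J \<le> ht (w ** nbr i ** nbr j))) = (\<Sum>i\<in>UNIV. F (ht (w ** nbr i)))"
    unfolding F_def q_def
    by (intro sum.cong refl) (simp only: nbr_sum[OF det_mult_nbr[OF w], of "\<lambda>n. of_bool (J \<le> n)"])
  also have "\<dots> = (if ht w = 0 then (q + 1) * F 1 else F (ht w + 1) + q * F (ht w - 1))"
    unfolding q_def by (rule nbr_sum[OF w])
  finally have S: "(\<Sum>i\<in>UNIV. \<Sum>j\<in>UNIV. of_bool (J \<le> ht (w ** nbr i ** nbr j))) = 
    (if ht w = 0 then (q + 1) * F 1 else F (ht w + 1) + q * F (ht w - 1))" .
  obtain m where m: "ht w = 2 * m" using even(1) by (elim evenE)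
  obtain l where l: "J = 2 * l" using even(2) by (elim evenE)
  have l0: "l \<noteq> 0" using J l by simp
  consider "m = 0" | "m \<noteq> 0" "l \<le> m - 1" | "m \<noteq> 0" "l = m" | "m \<noteq> 0" "l = m + 1" | "m \<noteq> 0" "m + 1 < l" by linarith
  then show ?thesis
    unfolding S m using l0 unfolding l F_def of_bool_def
    by cases (auto simp: power2_eq_square algebra_simps)
qed


section \<open>Irrational ends\<close>

lemma diag_Suc: "w ** mat2 (tt ^ Suc i) 0 0 1 = w ** mat2 (tt ^ i) 0 0 1 ** nbr None"
proof -
  have "mat2 (tt ^ Suc i) 0 0 1 = mat2 (tt ^ i) 0 0 1 ** nbr (None :: 'a option)" by (simp add: nbr_def)
  then show ?thesis by (simp only: matrix_mul_assoc)
qed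

lemma det_diag: "det w \<noteq> 0 \<Longrightarrow> det (w ** mat2 (tt ^ i) 0 0 1) \<noteq> 0"
  by (simp add: det_mul)

lemma represents_up:
  assumes "det u \<noteq> 0" "\<gamma> \<in> GL2_poly" "represents \<gamma> u (Suc m)" "ht (u ** nbr None) = Suc (Suc m)"
  shows "represents \<gamma> (u ** nbr None) (Suc (Suc m))"
proof -
  obtain i0 where i0: "represents \<gamma> (u ** nbr i0) (Suc (Suc m))" "\<And>i. i \<noteq> i0 \<Longrightarrow> has_height (u ** nbr i) m"
    using represents_nbr_Suc[OF assms(3,2)] by metis
  have "i0 = None"
  proof (rule ccontr)
    assume "i0 \<noteq> None"
    then have "has_height (u ** nbr None) m" using i0(2) by metis
    then show False using ht_eq[OF _ det_mult_nbr[OF assms(1)]] assms(4) by force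
  qed
  then show ?thesis using i0(1) by simp
qed

lemma represents_up_forever:
  assumes "det w \<noteq> 0" "\<gamma> \<in> GL2_poly" "represents \<gamma> w (Suc n)"
    and "\<And>i. ht (w ** mat2 (tt ^ i) 0 0 1) = Suc n + i"
  shows "represents \<gamma> (w ** mat2 (tt ^ i) 0 0 1) (Suc n + i)"
proof (induction i)
  case 0
  then show ?case using assms(3) by (simp flip: mat_mat2)
next
  case (Suc i)
  show ?case
    using represents_up[OF det_diag[OF assms(1)] assms(2), of i "n + i"] Suc assms(4)[of "Suc i"]
    unfolding diag_Suc by simp
qed

text \<open>Comparing determinants shows that the scalar in the representation has the same valuation for all
  \<open>i\<close>, while the lower left entry of \<open>\<delta> ** w\<close>, multiplied by \<open>t\<^sup>i\<close>, remains an integral multiple of this scalar.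
  Hence this entry vanishes.\<close>
lemma represents_forever_imp_lower_left_zero:
  assumes "det w \<noteq> 0" "\<gamma> \<in> GL2_poly" "\<And>i. represents \<gamma> (w ** mat2 (tt ^ i) 0 0 1) (n + i)"
  obtains p q s where "w = \<gamma> ** mat2 p q 0 s"
proof -
  obtain \<delta> where \<delta>: "\<delta> \<in> GL2_poly" "\<gamma> ** \<delta> = mat 1" "\<delta> ** \<gamma> = mat 1" using assms(2) by (rule GL2_poly_inverse)
  obtain p q r s where h: "\<delta> ** w = mat2 p q r s" by (rule mat2_cases)
  have dh: "det (\<delta> ** w) \<noteq> 0" using assms(1) GL2_poly_det[OF \<delta>(1)] by (simp add: det_mul)
  have "r = 0"
  proof (rule ccontr)
    assume r: "r \<noteq> 0"
    \<comment> \<open>The quotient by \<open>2\<close> is the valuation of the scalar \<open>z\<close> below.\<close>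
    define i where "i = nat (fls_subdegree r - (fls_subdegree (det (\<delta> ** w)) + int n) div 2 + 1)"
    obtain k z where k: "k \<in> GL2_int" "z \<noteq> 0"
      "w ** mat2 (tt ^ i) 0 0 1 = \<gamma> ** mat2 (tt ^ (n + i)) 0 0 1 ** k ** mat z"
      using assms(3)[of i] by (rule representsE)
    have "\<delta> ** (w ** mat2 (tt ^ i) 0 0 1) = \<delta> ** \<gamma> ** mat2 (tt ^ (n + i)) 0 0 1 ** k ** mat z"
      by (simp only: k(3) matrix_mul_assoc)
    then have eq: "\<delta> ** w ** mat2 (tt ^ i) 0 0 1 = mat2 (tt ^ (n + i)) 0 0 1 ** k ** mat z"
      by (simp only: \<delta> matrix_mul_assoc matrix_mul_lid)
    have "det (\<delta> ** w) * tt ^ i = tt ^ (n + i) * det k * (z * z)"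
      using arg_cong[OF eq, of det] unfolding det_mul by (simp add: mat_mat2)
    then have "fls_subdegree (det (\<delta> ** w) * tt ^ i) = fls_subdegree (tt ^ (n + i) * det k * (z * z))"
      by (simp only:)
    then have vz: "fls_subdegree (det (\<delta> ** w)) + int n = 2 * fls_subdegree z"
      using k(1,2) dh by (simp add: GL2_int_def del: det_mul power_add)
    obtain a b c d where kk: "k = mat2 a b c d" by (rule mat2_cases)
    have e: "r * tt ^ i = c * z" using eq by (simp add: h kk mat_mat2)
    then have "c \<noteq> 0" using r by auto
    then have "fls_subdegree r - int i = fls_subdegree c + fls_subdegree z"
      using arg_cong[OF e, of fls_subdegree] r k(2) by simp
    then have "fls_subdegree r - int i \<ge> fls_subdegree z"
      using int_ring_subdegree[OF GL2_int_D(3)[OF k(1)[unfolded kk]]] by linarith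
    moreover have "fls_subdegree r - fls_subdegree z + 1 \<le> int i" unfolding i_def vz by simp
    ultimately show False by linarith
  qed
  have "w = \<gamma> ** (\<delta> ** w)" by (simp add: matrix_mul_assoc \<delta>)
  then show ?thesis using that h \<open>r = 0\<close> by metis
qed

lemma poly_ring_subset_rat: "x \<in> poly_ring \<Longrightarrow> x \<in> rat_field"
  unfolding rat_field_def using poly_ring_closed(2) by (intro CollectI exI[of _ x] exI[of _ 1]) auto

text \<open>The matrix \<open>\<gamma> ** mat2 p q 0 s\<close> maps \<open>\<infinity>\<close> to \<open>\<gamma>\<infinity>\<close>, which is the first column of \<open>\<gamma>\<close>.\<close>
lemma xi_rational:
  fixes g :: "'a::{finite,field} fls^2^2"
  assumes "det g \<noteq> 0" "\<gamma> \<in> GL2_poly" "g ** mat2 (tt ^ M) 0 0 1 = \<gamma> ** mat2 p q 0 s"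
  shows "xi g \<in> P1_rat"
proof -
  obtain a b c d where \<gamma>: "\<gamma> = mat2 a b c d" by (rule mat2_cases)
  obtain a' b' c' d' where g: "g = mat2 a' b' c' d'" by (rule mat2_cases)
  have e: "a' * tt ^ M = a * p" "c' * tt ^ M = c * p" using assms(3) by (auto simp: g \<gamma>)
  define x where "x = p * fls_X ^ M"
  have "tt ^ M * fls_X ^ M = (1 :: 'a fls)" by (simp add: power_mult_distrib[symmetric])
  then have inv: "y * tt ^ M * fls_X ^ M = y" for y :: "'a fls" by (simp add: mult.assoc)
  have x: "a' = x * a" "c' = x * c" using inv[of a'] inv[of c'] unfolding e x_def by (simp_all add: mult_ac)
  have "a' \<noteq> 0 \<or> c' \<noteq> 0" using assms(1) by (auto simp: g)
  then have nz: "x \<noteq> 0" "(a, c) \<noteq> (0, 0)" using x by auto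
  have "xi g = proj_pt a c"
    unfolding xi_def proj_pt_def vec.span_singleton
  proof (intro equalityI subsetI)
    fix v assume "v \<in> (*v) g ` range (\<lambda>k. k *s vector [1, 0])"
    then obtain k where "v = g *v (k *s vector [1, 0])" by blast
    then have "v = (k * x) *s vector [a, c]" by (simp add: g x mat2_vec vec_eq_iff forall_2)
    then show "v \<in> range (\<lambda>k. k *s vector [a, c])" by blast
  next
    fix v :: "'a fls^2" assume "v \<in> range (\<lambda>k. k *s vector [a, c])"
    then obtain k where "v = k *s vector [a, c]" by blast
    then have "v = g *v ((k / x) *s vector [1, 0])" using nz by (simp add: g x mat2_vec vec_eq_iff forall_2)
    then show "v \<in> (*v) g ` range (\<lambda>k. k *s vector [1, 0])" by blast
  qed
  moreover have "a \<in> rat_field" "c \<in> rat_field"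
    using assms(2) by (auto simp: \<gamma> GL2_poly_def mats_over_mat2 intro: poly_ring_subset_rat)
  ultimately show ?thesis using nz(2) unfolding P1_rat_def by blast
qed

text \<open>A height that increases forever along the ray towards \<open>g\<infinity>\<close> would keep the ray in one cusp, whose
  end is rational.\<close>
lemma irrational_down:
  assumes "det g \<noteq> 0" "xi g \<notin> P1_rat"
  shows "\<exists>N\<ge>L. ht (g ** mat2 (tt ^ Suc N) 0 0 1) \<noteq> Suc (ht (g ** mat2 (tt ^ N) 0 0 1))"
proof (rule ccontr)
  assume "\<not> ?thesis"
  then have up: "ht (g ** mat2 (tt ^ Suc N) 0 0 1) = Suc (ht (g ** mat2 (tt ^ N) 0 0 1))" if "L \<le> N" for N
    using that by auto
  define w where "w = g ** mat2 (tt ^ Suc L) 0 0 1"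
  define n where "n = ht (g ** mat2 (tt ^ L) 0 0 1)"
  have w: "w ** mat2 (tt ^ i) 0 0 1 = g ** mat2 (tt ^ (Suc L + i)) 0 0 1" for i
    unfolding w_def by (simp add: power_add mult_ac flip: matrix_mul_assoc)
  have ht: "ht (w ** mat2 (tt ^ i) 0 0 1) = Suc n + i" for i
    unfolding w by (induction i) (use up n_def in \<open>auto simp del: power_Suc\<close>)
  have dw: "det w \<noteq> 0" unfolding w_def by (rule det_diag[OF assms(1)])
  have "ht w = Suc n" using ht[of 0] by (simp flip: mat_mat2)
  then obtain \<gamma> where \<gamma>: "\<gamma> \<in> GL2_poly" "represents \<gamma> w (Suc n)"
    using has_height_ht[OF dw] has_heightE by metis
  obtain p q s where "w = \<gamma> ** mat2 p q 0 s"
    using represents_forever_imp_lower_left_zero[OF dw \<gamma>(1) represents_up_forever[OF dw \<gamma> ht]] .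
  then show False using xi_rational[OF assms(1) \<gamma>(1), of "Suc L"] assms(2) unfolding w_def by metis
qed

text \<open>The difference between \<open>N\<close> and the height never decreases, and it grows by \<open>2\<close> with each downward
  step.\<close>
lemma irrational_height_gap:
  assumes "det g \<noteq> 0" "xi g \<notin> P1_rat"
  shows "\<forall>\<^sub>F N in sequentially. ht (g ** mat2 (tt ^ N) 0 0 1) + M \<le> N"
proof -
  define n where "n N = ht (g ** mat2 (tt ^ N) 0 0 1)" for N
  define D where "D N = int N - int (n N)" for N
  have step: "n (Suc N) = Suc (n N) \<or> Suc (n (Suc N)) = n N" for N
    unfolding n_def diag_Suc by (rule ht_nbr_up_or_down[OF det_diag[OF assms(1)]])
  have "D N \<le> D (Suc N)" for N using step[of N] by (auto simp: D_def)
  then have mono: "N \<le> N' \<Longrightarrow> D N \<le> D N'" for N N' by (rule lift_Suc_mono_le)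
  have unb: "\<exists>N. D 0 + int m \<le> D N" for m
  proof (induction m)
    case 0 then show ?case by (auto intro: exI[of _ 0])
  next
    case (Suc m)
    then obtain N where N: "D 0 + int m \<le> D N" ..
    obtain N' where N': "N \<le> N'" "n (Suc N') \<noteq> Suc (n N')"
      using irrational_down[OF assms, of N] unfolding n_def by blast
    then have "D (Suc N') \<ge> D N' + 1" using step[of N'] by (auto simp: D_def)
    then have "D 0 + int (Suc m) \<le> D (Suc N')" using mono[OF N'(1)] N by simp
    then show ?case ..
  qed
  obtain N0 where N0: "D 0 + int (M + n 0) \<le> D N0" using unb by blast
  show ?thesis unfolding eventually_sequentially
  proof (intro exI allI impI)
    fix N assume "N0 \<le> N"
    then have "D 0 + int (M + n 0) \<le> D N" using mono N0 by fastforce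
    then show "ht (g ** mat2 (tt ^ N) 0 0 1) + M \<le> N" by (simp add: D_def flip: n_def)
  qed
qed

lemma ht_diag_parity:
  assumes "det g = 1" shows "even (N + ht (g ** mat2 (tt ^ N) 0 0 1))"
  using has_height_parity[OF has_height_ht[of "g ** mat2 (tt ^ N) 0 0 1"]] assms
  by (simp add: det_mul)

lemma high_descendants_irrational:
  fixes g :: "'a::{finite,field} fls^2^2"
  assumes "det g = 1" "xi g \<notin> P1_rat" "even J" "1 \<le> J"
  shows "\<forall>\<^sub>F N in sequentially. J \<le> N \<and> high_descendants J N (g ** mat2 (tt ^ N) 0 0 1) = CARD('a) ^ (N + 1 - J)"
proof -
  have "det g \<noteq> 0" using assms(1) by simp
  from irrational_height_gap[OF this assms(2), of J] show ?thesis
  proof eventually_elim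
    case (elim N)
    then show ?case using ht_diag_parity[OF assms(1), of N] assms \<open>det g \<noteq> 0\<close>
      by (intro conjI high_descendants_far det_diag) auto
  qed
qed


section \<open>From cosets and measures to heights\<close>

lemma scaled_int_ring: "s \<in> (*) (tt ^ N) ` int_ring \<longleftrightarrow> (\<forall>n < - int N. s $$ n = 0)"
proof
  assume "s \<in> (*) (tt ^ N) ` int_ring"
  then obtain x where "s = tt ^ N * x" "x \<in> int_ring" by blast
  then show "\<forall>n < - int N. s $$ n = 0"
    by (simp add: fls_X_inv_power_times_conv_shift int_ring_nth)
next
  assume s: "\<forall>n < - int N. s $$ n = 0"
  have "tt ^ N * fls_X ^ N = (1 :: 'a fls)" by (simp add: power_mult_distrib[symmetric])
  then have "s = tt ^ N * (fls_X ^ N * s)" by (simp add: mult.assoc[symmetric])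
  moreover have "fls_X ^ N * s \<in> int_ring"
    using s by (simp add: int_ring_nth fls_X_power_times_conv_shift)
  ultimately show "s \<in> (*) (tt ^ N) ` int_ring" by blast
qed

lemma uu_mat2: "uu s = mat2 1 s 0 1"
  by (simp add: uu_def mat2_def)

lemma uu_add: "uu (a + b) = uu a ** uu b"
  by (simp add: uu_mat2 add.commute)

lemma det_uu [simp]: "det (uu s) = 1"
  by (simp add: uu_mat2)

text \<open>The metric is invariant under translations, so translations are continuous.\<close>
lemma borel_translate:
  fixes A :: "'a::{finite,field} fls set"
  assumes "A \<in> sets borel" shows "(+) a ` A \<in> sets borel"
proof -
  have d: "dist (x - a) (y - a) = dist x y" for x y :: "'a fls" by (simp add: dist_fls_def)
  have "continuous_on UNIV (\<lambda>x :: 'a fls. x - a)"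
    unfolding continuous_on_iff d by blast
  then have "(\<lambda>x :: 'a fls. x - a) \<in> borel \<rightarrow>\<^sub>M borel"
    by (rule borel_measurable_continuous_onI)
  then have "(\<lambda>x. x - a) -` A \<inter> space borel \<in> sets borel"
    using assms by (rule measurable_sets)
  moreover have "(\<lambda>x. x - a) -` A \<inter> space borel = (+) a ` A"
    by (auto intro!: image_eqI[of _ _ "_ - a"])
  ultimately show ?thesis by simp
qed

definition high_shifts :: "nat \<Rightarrow> nat \<Rightarrow> 'a::{finite,field} fls^2^2 \<Rightarrow> 'a fls set" where
  "high_shifts J N w = {s \<in> (*) (tt ^ N) ` int_ring. J \<le> ht (w ** uu s)}"

lemma high_shifts_0:
  assumes "det w \<noteq> 0" shows "high_shifts J 0 w = (if J \<le> ht w then int_ring else {})"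
proof -
  have "uu s \<in> GL2_int" if "s \<in> int_ring" for s :: "'a fls"
    using that by (simp add: uu_mat2 GL2_int_mat2)
  then show ?thesis using ht_int[OF assms] by (auto simp: high_shifts_def)
qed

text \<open>The set \<open>t\<^bsup>N + 1\<^esup> \<O>\<close> is the disjoint union of the translates of \<open>t\<^sup>N \<O>\<close> by \<open>c t\<^bsup>N + 1\<^esup>\<close>, one for each leading
  coefficient \<open>c\<close>.\<close>
lemma high_shifts_Suc:
  "high_shifts J (Suc N) w = (\<Union>c. (+) (fls_const c * tt ^ Suc N) ` high_shifts J N (w ** uu (fls_const c * tt ^ Suc N)))"
proof (intro equalityI subsetI)
  fix s assume s: "s \<in> high_shifts J (Suc N) w"
  define c where "c = s $$ (- int (Suc N))"
  define a where "a = fls_const c * tt ^ Suc N"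
  have "s - a \<in> (*) (tt ^ N) ` int_ring"
    unfolding scaled_int_ring
  proof (intro allI impI)
    fix n assume n: "n < - int N"
    show "(s - a) $$ n = 0"
    proof (cases "n = - int (Suc N)")
      case True then show ?thesis by (simp add: a_def c_def del: power_Suc)
    next
      case False
      then have "n < - int (Suc N)" using n by simp
      then show ?thesis using s unfolding high_shifts_def scaled_int_ring by (simp add: a_def del: power_Suc)
    qed
  qed
  moreover have "w ** uu a ** uu (s - a) = w ** uu s"
    using uu_add[of a "s - a"] by (simp flip: matrix_mul_assoc)
  ultimately have "s - a \<in> high_shifts J N (w ** uu a)" using s by (simp add: high_shifts_def)
  then have "s \<in> (+) a ` high_shifts J N (w ** uu a)" by (intro image_eqI[of _ _ "s - a"]) auto
  then show "s \<in> (\<Union>c. (+) (fls_const c * tt ^ Suc N) ` high_shifts J N (w ** uu (fls_const c * tt ^ Suc N)))"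
    unfolding a_def by blast
next
  fix s assume "s \<in> (\<Union>c. (+) (fls_const c * tt ^ Suc N) ` high_shifts J N (w ** uu (fls_const c * tt ^ Suc N)))"
  then obtain c r where r: "r \<in> high_shifts J N (w ** uu (fls_const c * tt ^ Suc N))"
    "s = fls_const c * tt ^ Suc N + r" by blast
  have "w ** uu s = w ** uu (fls_const c * tt ^ Suc N) ** uu r"
    unfolding r(2) uu_add by (rule matrix_mul_assoc)
  then show "s \<in> high_shifts J (Suc N) w"
    using r unfolding high_shifts_def scaled_int_ring by (auto simp del: power_Suc)
qed

text \<open>Splitting by the leading coefficient of \<open>s\<close> on the side of the measure corresponds to the choice of
  the first step away from the end on the side of the tree.\<close>
lemma emeasure_high_shifts:
  fixes ds :: "'a::{finite,field} fls measure"
  assumes "haar_measure ds" "emeasure ds int_ring = 1"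
  shows "det w \<noteq> 0 \<Longrightarrow> high_shifts J N w \<in> sets ds \<and>
    emeasure ds (high_shifts J N w) = of_nat (high_descendants J N (w ** mat2 (tt ^ N) 0 0 1))"
proof (induction N arbitrary: w)
  case 0
  have "int_ring \<in> sets ds" using assms(2) emeasure_notin_sets by fastforce
  then show ?case using assms(2) by (simp add: high_shifts_0[OF 0] flip: mat_mat2)
next
  case (Suc N)
  define a where "a c = fls_const c * tt ^ Suc N" for c :: 'a
  define F where "F c = (+) (a c) ` high_shifts J N (w ** uu (a c))" for c
  have sets: "sets ds = sets borel"
    and inv: "\<And>x A. A \<in> sets ds \<Longrightarrow> emeasure ds ((+) x ` A) = emeasure ds A"
    using assms(1) by (simp_all add: haar_measure_def)
  have dw: "det (w ** uu (a c)) \<noteq> 0" for c using Suc.prems by (simp add: det_mul)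
  note IH = Suc.IH[OF dw]
  have F: "F c \<in> sets ds" for c unfolding F_def using IH borel_translate sets by metis
  have child: "w ** uu (a c) ** mat2 (tt ^ N) 0 0 1 = w ** mat2 (tt ^ Suc N) 0 0 1 ** nbr (Some c)" for c
    by (simp add: uu_mat2 nbr_def a_def mult_ac flip: matrix_mul_assoc)
  have em: "emeasure ds (F c) = of_nat (high_descendants J N (w ** mat2 (tt ^ Suc N) 0 0 1 ** nbr (Some c)))" for c
    unfolding F_def using inv IH[of c] by (simp only: child)
  have lead: "s $$ (- int (Suc N)) = c" if "s \<in> F c" for s c
    using that unfolding F_def high_shifts_def scaled_int_ring by (auto simp: a_def simp del: power_Suc)
  have "disjoint_family_on F UNIV" unfolding disjoint_family_on_def using lead by blast
  then have "emeasure ds (\<Union>c\<in>UNIV. F c) = (\<Sum>c\<in>UNIV. emeasure ds (F c))"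
    using F by (intro sum_emeasure[symmetric]) auto
  moreover have U: "high_shifts J (Suc N) w = (\<Union>c\<in>UNIV. F c)"
    unfolding high_shifts_Suc F_def a_def ..
  ultimately show ?case using F by (auto simp: em)
qed

lemma carrier_SL2F: "g \<in> carrier SL2F \<longleftrightarrow> det g = 1"
  by (simp add: SL2F_def)

lemma Gam_iff: "\<gamma> \<in> Gam \<longleftrightarrow> det \<gamma> = 1 \<and> \<gamma> \<in> mats_over poly_ring"
  by (simp add: Gam_def SL2F_def)

lemma Gam_GL2_poly: "\<gamma> \<in> Gam \<Longrightarrow> \<gamma> \<in> GL2_poly"
  by (simp add: Gam_iff GL2_polyI)

lemma one_in_Gam: "mat 1 \<in> Gam"
  by (simp add: Gam_iff mat_mat2 mats_over_mat2)

lemma coset_eq: "coset g = (\<lambda>\<gamma>. \<gamma> ** g) ` Gam"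
  by (auto simp: coset_def r_coset_def SL2F_def)

lemma X_act_coset: "X_act (coset g) e = coset (g ** e)"
  unfolding coset_eq X_act_def by (auto simp: r_coset_def SL2F_def matrix_mul_assoc)

lemma XX_eq: "XX = coset ` {g. det g = 1}"
  by (auto simp: XX_def RCOSETS_def SL2F_def coset_def)

lemma self_in_coset: "g \<in> coset g"
  unfolding coset_eq by (rule image_eqI[OF _ one_in_Gam]) simp

lemma hK_coset:
  assumes "det g = 1" shows "hK (coset g) = ht g"
proof -
  have "ht (\<gamma> ** g) = ht g" if "\<gamma> \<in> Gam" for \<gamma>
    using ht_left[OF _ Gam_GL2_poly[OF that]] assms by simp
  then have "ht ` coset g = {ht g}" using imageI[OF self_in_coset[of g], of ht] by (auto simp: coset_eq)
  then show ?thesis unfolding hK_def by (simp add: ht_def)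
qed

lemma hK_even: "x \<in> XX \<Longrightarrow> even (hK x)"
  by (auto simp: XX_eq hK_coset ht_even)

text \<open>The union of a set of cosets is its preimage in the group, on which openness in the quotient is
  tested.\<close>
lemma Union_coset_sets:
  "\<Union> {x \<in> XX. hK (X_act x e) \<in> S} = {g. det g = 1 \<and> ht (g ** e) \<in> S}" if "det e = 1"
proof -
  have mem: "X_act (coset g) e = coset (g ** e)" "hK (coset (g ** e)) = ht (g ** e)" if "det g = 1" for g
    using that \<open>det e = 1\<close> by (simp_all add: X_act_coset hK_coset det_mul)
  have left: "ht (\<gamma> ** g ** e) = ht (g ** e)" if "\<gamma> \<in> Gam" "det g = 1" for \<gamma> g
    using ht_left[OF _ Gam_GL2_poly[OF that(1)], of "g ** e"] that \<open>det e = 1\<close>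
    by (simp add: det_mul matrix_mul_assoc)
  show ?thesis
  proof (intro equalityI subsetI)
    fix h assume "h \<in> \<Union> {x \<in> XX. hK (X_act x e) \<in> S}"
    then obtain g where g: "det g = 1" "h \<in> coset g" "hK (X_act (coset g) e) \<in> S" unfolding XX_eq by auto
    then obtain \<gamma> where "\<gamma> \<in> Gam" "h = \<gamma> ** g" unfolding coset_eq by blast
    then show "h \<in> {g. det g = 1 \<and> ht (g ** e) \<in> S}"
      using g mem left by (simp add: det_mul Gam_iff)
  next
    fix h assume h: "h \<in> {g. det g = 1 \<and> ht (g ** e) \<in> S}"
    then have "coset h \<in> {x \<in> XX. hK (X_act x e) \<in> S}" using mem by (auto simp: XX_eq)
    then show "h \<in> \<Union> {x \<in> XX. hK (X_act x e) \<in> S}" using self_in_coset by blast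
  qed
qed

lemma dist_small:
  fixes a b :: "'a::{finite,field} fls"
  assumes "dist a b < inverse (2 ^ m)" obtains y where "y \<in> int_ring" "a = b + fls_X ^ m * y"
proof (cases "a = b")
  case True then show ?thesis using that[of 0] by simp
next
  case False
  have sd: "int m \<le> fls_subdegree (a - b)"
  proof (rule ccontr)
    assume n: "\<not> int m \<le> fls_subdegree (a - b)"
    have "inverse (2 ^ m) \<le> dist a b"
    proof (cases "0 \<le> fls_subdegree (a - b)")
      case True
      then have "(2::real) ^ nat (fls_subdegree (a - b)) \<le> 2 ^ m" using n by (intro power_increasing) auto
      then show ?thesis using True False by (simp add: dist_fls_def le_imp_inverse_le)
    next
      case neg: False
      have "inverse ((2::real) ^ m) \<le> 1" by (simp add: inverse_le_1_iff)
      also have "1 \<le> (2::real) ^ nat (- fls_subdegree (a - b))" by simp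
      finally show ?thesis using neg False by (simp add: dist_fls_def)
    qed
    then show False using assms by simp
  qed
  have X: "fls_X ^ m * tt ^ m = (1 :: 'a fls)" by (simp add: power_mult_distrib[symmetric])
  have "fls_subdegree (tt ^ m * (a - b)) = fls_subdegree (a - b) - int m" using False by simp
  then have "tt ^ m * (a - b) \<in> int_ring" using sd by (simp add: int_ring_iff)
  moreover have "a = b + fls_X ^ m * (tt ^ m * (a - b))" using X by (simp add: mult.assoc[symmetric])
  ultimately show ?thesis using that by blast
qed

lemma scale_into_int_ring: "\<exists>M. \<forall>m\<ge>M. fls_X ^ m * x \<in> int_ring"
proof (intro exI allI impI)
  fix m assume "nat (- fls_subdegree x) \<le> m"
  then show "fls_X ^ m * x \<in> int_ring" by (cases "x = 0") (auto simp: int_ring_iff)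
qed

lemma scale_into_mats_over: "\<exists>M. mat (fls_X ^ M) ** A \<in> mats_over int_ring"
proof -
  obtain a b c d where A: "A = mat2 a b c d" by (rule mat2_cases)
  obtain Ma Mb Mc Md where "\<And>m. Ma \<le> m \<Longrightarrow> fls_X ^ m * a \<in> int_ring" "\<And>m. Mb \<le> m \<Longrightarrow> fls_X ^ m * b \<in> int_ring"
    "\<And>m. Mc \<le> m \<Longrightarrow> fls_X ^ m * c \<in> int_ring" "\<And>m. Md \<le> m \<Longrightarrow> fls_X ^ m * d \<in> int_ring"
    using scale_into_int_ring by metis
  then show ?thesis by (intro exI[of _ "Ma + Mb + Mc + Md"]) (simp add: A mat_mat2 mats_over_mat2)
qed

lemma mats_over_int_mult: "A \<in> mats_over int_ring \<Longrightarrow> B \<in> mats_over int_ring \<Longrightarrow> A ** B \<in> mats_over int_ring"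
  by (cases A rule: mat2_cases, cases B rule: mat2_cases) (auto simp: mats_over_mat2)

lemma mat2_add: "mat2 a b c d + mat2 a' b' c' d' = mat2 (a + a') (b + b') (c + c') (d + d')"
  for a :: "'b::monoid_add"
  by (simp add: vec_eq_iff forall_2)

lemma matrix_add_right_distrib: "(A + B) ** C = A ** C + B ** C" for A B C :: "'b::semiring_1^2^2"
  by (cases A rule: mat2_cases, cases B rule: mat2_cases, cases C rule: mat2_cases)
     (simp add: mat2_add algebra_simps)

lemma one_plus_small_GL2_int:
  assumes "A \<in> mats_over int_ring" shows "mat 1 + mat fls_X ** A \<in> GL2_int"
proof -
  obtain a b c d where A: "A = mat2 a b c d" by (rule mat2_cases)
  have int: "a \<in> int_ring" "b \<in> int_ring" "c \<in> int_ring" "d \<in> int_ring"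
    using assms by (auto simp: A mats_over_mat2)
  define D where "D = (1 + fls_X * a) * (1 + fls_X * d) - fls_X * b * (fls_X * c)"
  define y where "y = a + d + fls_X * (a * d - b * c)"
  have "D = 1 + fls_X * y" by (simp add: D_def y_def algebra_simps)
  moreover have y: "y \<in> int_ring" using int by (simp add: y_def)
  moreover have "(fls_X * y) $$ 0 = 0" using int_ring_mult_nth0[OF _ y, of fls_X] by simp
  ultimately have "D $$ 0 = 1" "D \<in> int_ring" by simp_all
  then have "D \<noteq> 0" "fls_subdegree D = 0"
    by (auto simp: int_ring_iff intro!: antisym fls_subdegree_leI)
  then show ?thesis using int by (simp add: A mat_mat2 mat2_add GL2_int_mat2 flip: D_def)
qed

text \<open>The height is invariant under right multiplication by \<open>GL2_int\<close>, which is a neighbourhood of \<open>1\<close>.\<close>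
lemma ht_locally_constant:
  fixes g e :: "'a::{finite,field} fls^2^2"
  assumes "det g \<noteq> 0" "det e \<noteq> 0"
  obtains T where "open T" "g \<in> T" "\<And>h. h \<in> T \<Longrightarrow> ht (h ** e) = ht (g ** e)"
proof -
  have dge: "det (g ** e) \<noteq> 0" using assms by (simp add: det_mul)
  obtain A where A: "(g ** e) ** A = mat 1" using invertible2[OF dge] .
  obtain M1 where M1: "mat (fls_X ^ M1) ** A \<in> mats_over int_ring" using scale_into_mats_over by blast
  obtain M2 where M2: "mat (fls_X ^ M2) ** e \<in> mats_over int_ring" using scale_into_mats_over by blast
  \<comment> \<open>The additional factor \<open>1/t\<close> makes the perturbation congruent to \<open>1\<close>, hence invertible.\<close>
  define m where "m = Suc (M1 + M2)"
  define B where "B i j = {h :: 'a fls^2^2. h $ i $ j \<in> ball (g $ i $ j) (inverse (2 ^ m))}" for i j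
  have opB: "open (B i j)" for i j
  proof -
    have "B i j = (\<lambda>h. h $ i) -` ((\<lambda>v. v $ j) -` ball (g $ i $ j) (inverse (2 ^ m)))"
      by (auto simp: B_def)
    then show ?thesis by (simp add: open_vimage_vec_nth)
  qed
  show ?thesis
  proof (rule that[of "B 1 1 \<inter> B 1 2 \<inter> B 2 1 \<inter> B 2 2"])
    show "open (B 1 1 \<inter> B 1 2 \<inter> B 2 1 \<inter> B 2 2)" by (intro open_Int opB)
    show "g \<in> B 1 1 \<inter> B 1 2 \<inter> B 2 1 \<inter> B 2 2" by (simp add: B_def)
  next
    fix h assume h: "h \<in> B 1 1 \<inter> B 1 2 \<inter> B 2 1 \<inter> B 2 2"
    have ex: "\<exists>y\<in>int_ring. h $ i $ j = g $ i $ j + fls_X ^ m * y" if "h \<in> B i j" for i j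
    proof -
      have "dist (h $ i $ j) (g $ i $ j) < inverse (2 ^ m)" using that by (simp add: B_def dist_commute)
      then show ?thesis using dist_small by metis
    qed
    obtain a b c d where y: "a \<in> int_ring" "b \<in> int_ring" "c \<in> int_ring" "d \<in> int_ring"
      "h $ 1 $ 1 = g $ 1 $ 1 + fls_X ^ m * a" "h $ 1 $ 2 = g $ 1 $ 2 + fls_X ^ m * b"
      "h $ 2 $ 1 = g $ 2 $ 1 + fls_X ^ m * c" "h $ 2 $ 2 = g $ 2 $ 2 + fls_X ^ m * d"
      using ex h by (metis IntE)
    define E where "E = mat2 a b c d"
    have E: "E \<in> mats_over int_ring" using y by (simp add: E_def mats_over_mat2)
    have hg: "h = g + mat (fls_X ^ m) ** E"
      using y by (simp add: vec_eq_iff forall_2 E_def mat_mat2)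
    define C where "C = (mat (fls_X ^ M1) ** A) ** E ** (mat (fls_X ^ M2) ** e)"
    have C: "C \<in> mats_over int_ring" unfolding C_def by (intro mats_over_int_mult M1 M2 E)
    have "mat fls_X ** C = A ** E ** e ** mat (fls_X ^ m)"
      unfolding C_def m_def
      by (cases A rule: mat2_cases, cases e rule: mat2_cases)
         (simp add: E_def mat_mat2 power_add algebra_simps)
    then have "(g ** e) ** (mat fls_X ** C) = (g ** e) ** A ** E ** e ** mat (fls_X ^ m)"
      by (simp add: matrix_mul_assoc)
    also have "\<dots> = E ** e ** mat (fls_X ^ m)" by (simp add: A)
    also have "\<dots> = mat (fls_X ^ m) ** E ** e"
      by (rule trans[OF mat_commute matrix_mul_assoc])
    finally have "(g ** e) ** (mat 1 + mat fls_X ** C) = h ** e"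
      by (simp add: hg matrix_add_ldistrib matrix_add_right_distrib)
    then show "ht (h ** e) = ht (g ** e)"
      using ht_int[OF dge one_plus_small_GL2_int[OF C]] by metis
  qed
qed

lemma hK_sets:
  assumes "det e = 1"
  shows "{x \<in> XX. hK (X_act x e) \<in> S} \<in> sets (borel_X :: ('a::{finite,field} fls^2^2) set measure)"
proof -
  have "openin (top_of_set (carrier SL2F)) {g. det g = 1 \<and> ht (g ** e) \<in> S}"
    unfolding openin_subopen[of _ "{g. det g = 1 \<and> ht (g ** e) \<in> S}"]
  proof (intro ballI)
    fix g assume g: "g \<in> {g. det g = 1 \<and> ht (g ** e) \<in> S}"
    then obtain T where T: "open T" "g \<in> T" "\<And>h. h \<in> T \<Longrightarrow> ht (h ** e) = ht (g ** e)"
      using ht_locally_constant[of g e] assms by auto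
    have "carrier SL2F \<inter> T \<subseteq> {g. det g = 1 \<and> ht (g ** e) \<in> S}"
    proof
      fix h assume "h \<in> carrier SL2F \<inter> T"
      then show "h \<in> {g. det g = 1 \<and> ht (g ** e) \<in> S}" using T(3)[of h] g by (simp add: carrier_SL2F)
    qed
    moreover have "g \<in> carrier SL2F \<inter> T" using T(2) g by (simp add: carrier_SL2F)
    ultimately show "\<exists>T. openin (top_of_set (carrier SL2F)) T \<and> g \<in> T \<and> T \<subseteq> {g. det g = 1 \<and> ht (g ** e) \<in> S}"
      using openin_open_Int[OF T(1), of "carrier SL2F"] by (intro exI[of _ "carrier SL2F \<inter> T"] conjI)
  qed
  then have "openin (top_of_set (carrier SL2F)) (\<Union> {x \<in> XX. hK (X_act x e) \<in> S})"
    by (simp only: Union_coset_sets[OF assms])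
  then have "{x \<in> XX. hK (X_act x e) \<in> S} \<in> {U. U \<subseteq> XX \<and> openin (top_of_set (carrier SL2F)) (\<Union>U)}"
    by (intro CollectI conjI) auto
  then show ?thesis unfolding borel_X_def
    by (subst sets_measure_of) (blast, rule sigma_sets.Basic)
qed


section \<open>The two distributions of the height\<close>

lemma card_field_ge_2: "2 \<le> CARD('a::{finite,field})"
proof -
  have "card {0, 1 :: 'a} \<le> CARD('a)" by (rule card_mono) auto
  then show ?thesis by simp
qed

lemma space_invariant: "invariant_prob_measure \<mu> \<Longrightarrow> space \<mu> = XX"
  using sets_eq_imp_space_eq[of \<mu> borel_X]
  by (simp add: invariant_prob_measure_def borel_X_def space_measure_of_conv)

lemma X_act_one: "x \<in> XX \<Longrightarrow> X_act x (mat 1) = x"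
  by (auto simp: XX_eq X_act_coset)

lemma hK_sets_invariant:
  assumes "invariant_prob_measure \<mu>" "det e = 1"
  shows "{x \<in> XX. hK (X_act x e) \<in> S} \<in> sets \<mu>"
  using assms hK_sets[OF assms(2)] by (simp add: invariant_prob_measure_def)

lemma hK_sets_invariant_one:
  fixes \<mu> :: "('a::{finite,field} fls^2^2) set measure"
  assumes "invariant_prob_measure \<mu>"
  shows "{x \<in> XX. hK x \<in> S} \<in> sets \<mu>"
proof -
  have "{x \<in> XX :: ('a fls^2^2) set set. hK x \<in> S} = {x \<in> XX. hK (X_act x (mat 1)) \<in> S}"
    by (auto simp: X_act_one)
  then show ?thesis using hK_sets_invariant[OF assms, of "mat 1"] by simp
qed

text \<open>Invariance is stated for images; the set on the left is carried onto the set on the right by the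
  action of \<open>e\<close>.\<close>
lemma measure_translate:
  fixes \<mu> :: "('a::{finite,field} fls^2^2) set measure"
  assumes "invariant_prob_measure \<mu>" "det e = 1"
  shows "measure \<mu> {x \<in> XX. hK (X_act x e) \<in> S} = measure \<mu> {x \<in> XX. hK x \<in> S}"
proof -
  let ?A = "{x \<in> XX. hK (X_act x e) \<in> S}"
  have "det e \<noteq> 0" using assms(2) by simp
  then obtain e' where e': "e ** e' = mat 1" "e' ** e = mat 1" by (rule invertible2)
  have "det e * det e' = 1" using e'(1) by (metis det_mul det_I)
  then have d: "det e' = 1" using assms(2) by simp
  have "(\<lambda>x. X_act x e) ` ?A = {x \<in> XX. hK x \<in> S}"
  proof (intro equalityI subsetI)
    fix y assume "y \<in> (\<lambda>x. X_act x e) ` ?A"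
    then show "y \<in> {x \<in> XX. hK x \<in> S}" using assms(2) by (auto simp: XX_eq X_act_coset det_mul)
  next
    fix y :: "('a fls^2^2) set" assume y: "y \<in> {x \<in> XX. hK x \<in> S}"
    then obtain g where g: "y = coset g" "det g = 1" by (auto simp: XX_eq)
    have "X_act (coset (g ** e')) e = y" using e' g by (simp add: X_act_coset flip: matrix_mul_assoc)
    moreover have "coset (g ** e') \<in> XX" using g d by (simp add: XX_eq det_mul)
    ultimately show "y \<in> (\<lambda>x. X_act x e) ` ?A" using y by (intro image_eqI[of _ _ "coset (g ** e')"]) auto
  qed
  moreover have "emeasure \<mu> ((\<lambda>x. X_act x e) ` ?A) = emeasure \<mu> ?A"
    using assms hK_sets_invariant[OF assms] by (simp add: invariant_prob_measure_def carrier_SL2F)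
  ultimately show ?thesis by (simp add: measure_def)
qed

text \<open>The product of two neighbour matrices has determinant an even power of \<open>t\<close>, so a scalar makes it \<open>1\<close>
  and the measure is invariant under the result.\<close>
lemma two_step_element:
  fixes i j :: "'a::{finite,field} option"
  shows "\<exists>e. det e = 1 \<and> (\<forall>w. det w \<noteq> 0 \<longrightarrow> ht (w ** nbr i ** nbr j) = ht (w ** e))"
proof -
  have "\<exists>z. z \<noteq> 0 \<and> det (nbr i ** nbr j ** mat z) = 1"
  proof (cases "i = None \<longleftrightarrow> j = None")
    case False
    then show ?thesis by (intro exI[of _ 1]) (cases i; cases j; simp add: nbr_def mat_mat2)
  next
    case True
    show ?thesis
    proof (cases i)
      case None
      then show ?thesis using True by (intro exI[of _ fls_X]) (simp add: nbr_def mat_mat2 mult_ac)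
    next
      case (Some c)
      then obtain d where "j = Some d" using True by auto
      then show ?thesis using Some by (intro exI[of _ tt]) (simp add: nbr_def mat_mat2 mult_ac)
    qed
  qed
  then obtain z where z: "z \<noteq> 0" "det (nbr i ** nbr j ** mat z) = 1" by blast
  show ?thesis
  proof (intro exI conjI allI impI)
    show "det (nbr i ** nbr j ** mat z) = 1" by (rule z(2))
    fix w :: "'a fls^2^2" assume "det w \<noteq> 0"
    then have "ht (w ** nbr i ** nbr j ** mat z) = ht (w ** nbr i ** nbr j)"
      using ht_scale[OF det_mult_nbr[OF det_mult_nbr] z(1)] by blast
    then show "ht (w ** nbr i ** nbr j) = ht (w ** (nbr i ** nbr j ** mat z))"
      by (simp only: matrix_mul_assoc)
  qed
qed

text \<open>Integration of the pointwise identity \<open>two_step_sum\<close>: by invariance all \<open>(q + 1)\<^sup>2\<close> translates of the set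
  of heights at least \<open>J\<close> have the measure of this set, and these terms cancel.\<close>
lemma detailed_balance:
  fixes \<mu> :: "('a::{finite,field} fls^2^2) set measure"
  defines "q \<equiv> real CARD('a)"
  assumes inv: "invariant_prob_measure \<mu>" and J: "even J" "2 \<le> J"
  shows "q\<^sup>2 * measure \<mu> {x \<in> XX. hK x = J} = (if J = 2 then q + 1 else 1) * measure \<mu> {x \<in> XX. hK x + 2 = J}"
proof -
  interpret prob_space \<mu> using inv by (simp add: invariant_prob_measure_def)
  obtain E :: "'a option \<Rightarrow> 'a option \<Rightarrow> 'a fls^2^2" where E: "\<And>i j. det (E i j) = 1"
    "\<And>i j w. det w \<noteq> 0 \<Longrightarrow> ht (w ** nbr i ** nbr j) = ht (w ** E i j)"
    using two_step_element by metis
  define A where "A i j = {x \<in> XX. hK (X_act x (E i j)) \<in> {J..}}" for i j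
  define C where "C = {x \<in> XX :: ('a fls^2^2) set set. hK x \<in> {J..}}"
  define B where "B = {x \<in> XX :: ('a fls^2^2) set set. hK x \<in> {J}}"
  define P where "P = {x \<in> XX :: ('a fls^2^2) set set. hK x \<in> {n. n + 2 = J}}"
  define c where "c = (if J = 2 then q + 1 else 1)"
  have sets: "A i j \<in> sets \<mu>" "C \<in> sets \<mu>" "B \<in> sets \<mu>" "P \<in> sets \<mu>" for i j
    unfolding A_def B_def C_def P_def
    by (intro hK_sets_invariant hK_sets_invariant_one inv E)+
  have AC: "measure \<mu> (A i j) = measure \<mu> C" for i j
    unfolding A_def C_def by (rule measure_translate[OF inv E(1)])
  have pt: "(\<Sum>i\<in>UNIV. \<Sum>j\<in>UNIV. indicat_real (A i j) x) + q\<^sup>2 * indicat_real B x =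
      (q + 1)\<^sup>2 * indicat_real C x + c * indicat_real P x" if "x \<in> XX" for x
  proof -
    obtain g where g: "x = coset g" "det g = 1" using \<open>x \<in> XX\<close> by (auto simp: XX_eq)
    have hA: "indicat_real (A i j) x = real (of_bool (J \<le> ht (g ** nbr i ** nbr j)))" for i j
      using that g E by (auto simp: A_def of_bool_def X_act_coset hK_coset det_mul indicator_def)
    have "hK x = ht g" using g by (simp add: hK_coset)
    then have hB: "indicat_real B x = real (of_bool (ht g = J))"
      and hC: "indicat_real C x = real (of_bool (J \<le> ht g))"
      and hP: "indicat_real P x = real (of_bool (ht g + 2 = J))"
      using that by (simp_all add: B_def C_def P_def of_bool_def indicator_def)
    have "real ((\<Sum>i\<in>UNIV. \<Sum>j\<in>UNIV. of_bool (J \<le> ht (g ** nbr i ** nbr j))) + CARD('a)\<^sup>2 * of_bool (ht g = J)) =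
      real ((CARD('a) + 1)\<^sup>2 * of_bool (J \<le> ht g) + (if J = 2 then CARD('a) + 1 else 1) * of_bool (ht g + 2 = J))"
      using g ht_even[OF g(2)] J by (intro arg_cong[of _ _ real] two_step_sum) simp_all
    moreover have "real (if J = 2 then CARD('a) + 1 else 1) = c" by (simp add: c_def q_def)
    ultimately show ?thesis
      unfolding hA hB hC hP q_def of_nat_add of_nat_mult of_nat_sum of_nat_power of_nat_1 by simp
  qed
  have hb: "has_bochner_integral \<mu> (indicat_real S) (measure \<mu> S)" if "S \<in> sets \<mu>" for S
    using that by (intro has_bochner_integral_real_indicator) (auto simp: emeasure_eq_measure)
  have "has_bochner_integral \<mu> (\<lambda>x. (\<Sum>i\<in>UNIV. \<Sum>j\<in>UNIV. indicat_real (A i j) x) + q\<^sup>2 * indicat_real B x)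
      ((\<Sum>i\<in>(UNIV :: 'a option set). \<Sum>j\<in>(UNIV :: 'a option set). measure \<mu> (A i j)) + q\<^sup>2 * measure \<mu> B)"
    by (intro has_bochner_integral_add has_bochner_integral_sum has_bochner_integral_mult_right hb sets)
  moreover have "has_bochner_integral \<mu> (\<lambda>x. (q + 1)\<^sup>2 * indicat_real C x + c * indicat_real P x)
      ((q + 1)\<^sup>2 * measure \<mu> C + c * measure \<mu> P)"
    by (intro has_bochner_integral_add has_bochner_integral_mult_right hb sets)
  moreover have "has_bochner_integral \<mu> (\<lambda>x. (\<Sum>i\<in>UNIV. \<Sum>j\<in>UNIV. indicat_real (A i j) x) + q\<^sup>2 * indicat_real B x) v \<longleftrightarrow>
      has_bochner_integral \<mu> (\<lambda>x. (q + 1)\<^sup>2 * indicat_real C x + c * indicat_real P x) v" for v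
    by (intro has_bochner_integral_cong refl) (simp add: space_invariant[OF inv] pt)
  ultimately have "(\<Sum>i\<in>(UNIV :: 'a option set). \<Sum>j\<in>(UNIV :: 'a option set). measure \<mu> (A i j)) + q\<^sup>2 * measure \<mu> B
      = (q + 1)\<^sup>2 * measure \<mu> C + c * measure \<mu> P"
    using has_bochner_integral_eq by blast
  then have "q\<^sup>2 * measure \<mu> B = c * measure \<mu> P"
    by (simp add: AC card_UNIV_option q_def power2_eq_square algebra_simps)
  then show ?thesis by (simp add: B_def P_def c_def)
qed

text \<open>The mass of the height \<open>2 * k\<close>.  It is inversely proportional to the order of the
  stabiliser of the corresponding vertex in the modular group.\<close>
definition height_mass :: "real \<Rightarrow> nat \<Rightarrow> real" where
  "height_mass q k = (if k = 0 then (q - 1) / q else (q\<^sup>2 - 1) / q ^ (2 * k + 1))"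

text \<open>Detailed balance determines the masses up to a common factor, as a geometric sequence from height
  \<open>2\<close> on, and the total mass is one because all heights are even.\<close>
lemma measure_hK:
  fixes \<mu> :: "('a::{finite,field} fls^2^2) set measure"
  assumes inv: "invariant_prob_measure \<mu>"
  shows "measure \<mu> {x \<in> XX. hK x = 2 * k} = height_mass (real CARD('a)) k"
proof -
  interpret prob_space \<mu> using inv by (simp add: invariant_prob_measure_def)
  define q where "q = real CARD('a)"
  have q: "q \<ge> 2" using card_field_ge_2[where 'a='a] by (simp add: q_def)
  define b where "b k = measure \<mu> {x \<in> XX. hK x = 2 * k}" for k
  have rec: "q\<^sup>2 * b (Suc k) = (if k = 0 then q + 1 else 1) * b k" for k
    using detailed_balance[OF inv, of "2 * Suc k"] by (simp add: b_def q_def)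
  have geo: "b (Suc k) = b 0 * (q + 1) / q\<^sup>2 * (1 / q\<^sup>2) ^ k" for k
  proof (induction k)
    case 0 then show ?case using rec[of 0] q by (simp add: field_simps)
  next
    case (Suc k)
    have "b (Suc (Suc k)) = b (Suc k) / q\<^sup>2" using rec[of "Suc k"] q by (simp add: field_simps)
    then show ?case using Suc by simp
  qed
  have "(\<lambda>k. b k) sums measure \<mu> (\<Union>k. {x \<in> XX. hK x = 2 * k})"
    unfolding b_def
    using hK_sets_invariant_one[OF inv, of "{_}"]
    by (intro finite_measure_UNION) (auto simp: disjoint_family_on_def)
  moreover have "(\<Union>k. {x \<in> XX. hK x = 2 * k}) = space \<mu>"
    using hK_even by (fastforce simp: space_invariant[OF inv] elim: evenE)
  ultimately have "b sums 1" by (simp add: prob_space)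
  then have s1: "(\<lambda>k. b (Suc k)) sums (1 - b 0)" by (simp add: sums_Suc_iff)
  then have "(\<lambda>k. b 0 * (q + 1) / q\<^sup>2 * (1 / q\<^sup>2) ^ k) sums (b 0 * (q + 1) / q\<^sup>2 * (1 / (1 - 1 / q\<^sup>2)))"
    using q by (intro sums_mult geometric_sums) simp
  then have "1 - b 0 = b 0 * (q + 1) / q\<^sup>2 * (1 / (1 - 1 / q\<^sup>2))"
    using s1 sums_unique2 unfolding geo by blast
  also have "\<dots> = b 0 / (q - 1)"
  proof -
    have "1 - 1 / q\<^sup>2 = (q - 1) * (q + 1) / q\<^sup>2" using q by (simp add: field_simps power2_eq_square)
    then show ?thesis using q by simp
  qed
  finally have b0: "b 0 = (q - 1) / q" using q by (simp add: field_simps)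
  have "b k = height_mass q k"
  proof (cases k)
    case 0 then show ?thesis using b0 by (simp add: height_mass_def)
  next
    case (Suc m)
    have "b k = (q - 1) / q * (q + 1) / q\<^sup>2 * (1 / q\<^sup>2) ^ m" unfolding Suc geo b0 ..
    also have "\<dots> = (q - 1) / q * (q + 1) / q\<^sup>2 / (q\<^sup>2) ^ m" by (simp add: power_one_over)
    also have "\<dots> = (q\<^sup>2 - 1) / (q ^ 3 * (q\<^sup>2) ^ m)"
      by (simp add: power2_eq_square power3_eq_cube algebra_simps)
    also have "q ^ 3 * (q\<^sup>2) ^ m = q ^ (2 * k + 1)"
      unfolding Suc by (simp add: power_add power_mult power2_eq_square power3_eq_cube power_mult_distrib mult_ac)
    finally show ?thesis by (simp add: height_mass_def Suc)
  qed
  then show ?thesis by (simp add: b_def q_def)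
qed

lemma high_descendants_bound_zero: "high_descendants 0 N w = CARD('a) ^ N" for w :: "'a::{finite,field} fls^2^2"
  by (induction N arbitrary: w) simp_all

lemma even_eq_iff: "even n \<Longrightarrow> n = 2 * k \<longleftrightarrow> 2 * k \<le> n \<and> \<not> 2 * k + 2 \<le> n" for n k :: nat
  by (elim evenE) auto

text \<open>By parity, the height is \<open>2 * k\<close> if and only if it is at least \<open>2 * k\<close> but not at least \<open>2 * k + 2\<close>, so the
  measure is a difference of two counts.  The case \<open>k = 0\<close> is separate because there the first count is the number of all descendants.\<close>
lemma haar_measure_height:
  fixes ds :: "'a::{finite,field} fls measure"
  assumes ds: "haar_measure ds" "emeasure ds int_ring = 1" and g: "det g = 1" "xi g \<notin> P1_rat"
  defines "S k N \<equiv> {s \<in> (*) (tt ^ N) ` int_ring. ht (g ** uu s) = 2 * k}"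
  shows "S k N \<in> sets ds" "emeasure ds (S k N) < \<infinity>"
    "\<forall>\<^sub>F N in sequentially. measure ds (S k N) = real CARD('a) ^ N * height_mass (real CARD('a)) k"
proof -
  have dg: "det g \<noteq> 0" using g by simp
  note em = emeasure_high_shifts[OF ds dg]
  have S: "S k N = high_shifts (2 * k) N g - high_shifts (2 * k + 2) N g" for N
  proof -
    have "even (ht (g ** uu s))" for s by (rule ht_even) (simp add: det_mul g)
    then have "ht (g ** uu s) = 2 * k \<longleftrightarrow> 2 * k \<le> ht (g ** uu s) \<and> \<not> 2 * k + 2 \<le> ht (g ** uu s)" for s
      by (rule even_eq_iff)
    then show ?thesis by (auto simp: S_def high_shifts_def)
  qed
  show "S k N \<in> sets ds" unfolding S using em by blast
  have "emeasure ds (S k N) \<le> emeasure ds (high_shifts (2 * k) N g)"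
    unfolding S using em by (intro emeasure_mono) auto
  also have "\<dots> < \<infinity>" using em by (simp add: of_nat_less_top)
  finally show "emeasure ds (S k N) < \<infinity>" .
  define q where "q = real CARD('a)"
  have q: "q \<ge> 2" using card_field_ge_2[where 'a='a] by (simp add: q_def)
  let ?cnt = "\<lambda>J N. high_descendants J N (g ** mat2 (tt ^ N) 0 0 1)"
  have mS: "measure ds (S k N) = real (?cnt (2 * k) N) - real (?cnt (2 * k + 2) N)" for N
  proof -
    have "measure ds (S k N) = measure ds (high_shifts (2 * k) N g) - measure ds (high_shifts (2 * k + 2) N g)"
      unfolding S using em by (intro measure_Diff) (auto simp: high_shifts_def)
    then show ?thesis using em by (simp add: measure_def)
  qed
  have ev: "\<forall>\<^sub>F N in sequentially. J \<le> N \<and> ?cnt J N = CARD('a) ^ (N + 1 - J)" if "even J" "1 \<le> J" for J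
    using high_descendants_irrational[OF g that] .
  show "\<forall>\<^sub>F N in sequentially. measure ds (S k N) = real CARD('a) ^ N * height_mass (real CARD('a)) k"
  proof (cases "k = 0")
    case True
    have full: "?cnt 0 N = CARD('a) ^ N" for N by (rule high_descendants_bound_zero)
    have "even (2 * k + 2)" "1 \<le> 2 * k + 2" by simp_all
    from ev[OF this] show ?thesis
    proof eventually_elim
      case (elim N)
      define m where "m = N - 1"
      have N: "N = Suc m" "N + 1 - (2 * k + 2) = m" using elim by (auto simp: m_def True)
      have c1: "?cnt (2 * k) N = CARD('a) ^ N" by (simp only: True mult_0_right full)
      have c2: "?cnt (2 * k + 2) N = CARD('a) ^ m" using elim by (simp only: N(2))
      have "measure ds (S k N) = q ^ N - q ^ m" unfolding mS c1 c2 by (simp add: q_def)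
      also have "\<dots> = q ^ N * height_mass q k"
        using True q by (simp add: N(1) height_mass_def field_simps)
      finally show ?case by (simp add: q_def)
    qed
  next
    case False
    have "even (2 * k)" "1 \<le> 2 * k" "even (2 * k + 2)" "1 \<le> 2 * k + 2" using False by auto
    from ev[OF this(1,2)] ev[OF this(3,4)] show ?thesis
    proof eventually_elim
      case (elim N)
      define m where "m = N - 1 - 2 * k"
      have N: "N = m + 2 * k + 1" "N + 1 - 2 * k = m + 2" "N + 1 - (2 * k + 2) = m" 
        using elim by (auto simp: m_def)
      have "measure ds (S k N) = q ^ (m + 2) - q ^ m" unfolding mS using elim N by (simp add: q_def)
      also have "\<dots> = q ^ N * height_mass q k"
        using False q by (simp add: N(1) height_mass_def power_add field_simps power2_eq_square)
      finally show ?case by (simp add: q_def)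
    qed
  qed
qed

text \<open>The hypothesis leaves the values at odd arguments free, so the expansion is limited to even ones.\<close>
lemma even_supported_expansion:
  fixes \<Phi> :: "nat \<Rightarrow> complex"
  assumes "{n. even n \<and> \<Phi> n \<noteq> 0} \<subseteq> {n. even n \<and> n \<le> R}" "even n"
  shows "\<Phi> n = (\<Sum>k\<le>R. of_bool (n = 2 * k) *\<^sub>R \<Phi> (2 * k))"
proof -
  obtain m where m: "n = 2 * m" using assms(2) by (elim evenE)
  have "(\<Sum>k\<le>R. of_bool (n = 2 * k) *\<^sub>R \<Phi> (2 * k)) = (\<Sum>k\<le>R. if k = m then \<Phi> (2 * m) else 0)"
    by (intro sum.cong) (auto simp: m)
  also have "\<dots> = (if m \<le> R then \<Phi> (2 * m) else 0)" by simp
  also have "\<dots> = \<Phi> n"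
  proof (cases "\<Phi> n = 0")
    case False
    then have "n \<le> R" using assms by blast
    then show ?thesis by (simp add: m)
  qed (simp add: m)
  finally show ?thesis by simp
qed

theorem corollary5p6:
  fixes ds :: "'a::{finite,field} fls measure"
    and \<mu> :: "('a fls^2^2) set measure"
    and g :: "'a fls^2^2"
    and x :: "('a fls^2^2) set"
    and R :: nat
    and \<Phi> :: "nat \<Rightarrow> complex"
  assumes "haar_measure ds" and "emeasure ds int_ring = 1"
    and "invariant_prob_measure \<mu>"
    and "g \<in> carrier SL2F" and "x = coset g"
    and "xi g \<notin> P1_rat"
    and "even R"
    and "{n. even n \<and> \<Phi> n \<noteq> 0} \<subseteq> {n. even n \<and> n \<le> R}"
  shows "\<forall>\<^sub>F N in sequentially. lambda_den ds x N (\<Phi> \<circ> hK) = (\<integral>y. (\<Phi> \<circ> hK) y \<partial>\<mu>)"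
proof -
  define q where "q = real CARD('a)"
  have q: "q \<noteq> 0" by (simp add: q_def)
  have g: "det g = 1" using assms(4) by (simp add: carrier_SL2F)
  interpret prob_space \<mu> using assms(3) by (simp add: invariant_prob_measure_def)
  define S where "S k N = {s \<in> (*) (tt ^ N) ` int_ring. ht (g ** uu s) = 2 * k}" for k N
  note S = haar_measure_height[OF assms(1,2) g assms(6), folded S_def q_def]
  define L where "L k = {y \<in> XX :: ('a fls^2^2) set set. hK y = 2 * k}" for k
  have L: "L k \<in> sets \<mu>" for k
    using hK_sets_invariant_one[OF assms(3), of "{2 * k}"] by (simp add: L_def)
  note expand = even_supported_expansion[OF assms(8)]
  have right: "(\<integral>y. (\<Phi> \<circ> hK) y \<partial>\<mu>) = (\<Sum>k\<le>R. height_mass q k *\<^sub>R \<Phi> (2 * k))"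
  proof -
    have "(\<integral>y. (\<Phi> \<circ> hK) y \<partial>\<mu>) = (\<integral>y. (\<Sum>k\<le>R. indicat_real (L k) y *\<^sub>R \<Phi> (2 * k)) \<partial>\<mu>)"
    proof (intro Bochner_Integration.integral_cong refl)
      fix y assume "y \<in> space \<mu>"
      then have y: "y \<in> XX" by (simp add: space_invariant[OF assms(3)])
      then show "(\<Phi> \<circ> hK) y = (\<Sum>k\<le>R. indicat_real (L k) y *\<^sub>R \<Phi> (2 * k))"
        using expand[OF hK_even[OF y]] by (simp add: L_def indicator_def)
    qed
    also have "\<dots> = (\<Sum>k\<le>R. measure \<mu> (L k) *\<^sub>R \<Phi> (2 * k))"
      using L by (intro has_bochner_integral_integral_eq has_bochner_integral_sum
          has_bochner_integral_scaleR_left has_bochner_integral_real_indicator)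
        (auto simp: emeasure_eq_measure)
    finally show ?thesis by (simp add: L_def measure_hK[OF assms(3)] q_def)
  qed
  have left: "lambda_den ds x N (\<Phi> \<circ> hK) = inverse (q ^ N) *\<^sub>R (\<Sum>k\<le>R. measure ds (S k N) *\<^sub>R \<Phi> (2 * k))" for N
  proof -
    have hK: "hK (X_act x (uu s)) = ht (g ** uu s)" "even (ht (g ** uu s))" for s
      using g by (simp_all add: assms(5) X_act_coset hK_coset det_mul ht_even)
    have "(\<integral>s \<in> (*) (tt ^ N) ` int_ring. (\<Phi> \<circ> hK) (X_act x (uu s)) \<partial>ds) =
        (\<integral>s. (\<Sum>k\<le>R. indicat_real (S k N) s *\<^sub>R \<Phi> (2 * k)) \<partial>ds)"
      unfolding set_lebesgue_integral_def
    proof (intro Bochner_Integration.integral_cong refl)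
      fix s
      show "indicat_real ((*) (tt ^ N) ` int_ring) s *\<^sub>R (\<Phi> \<circ> hK) (X_act x (uu s)) =
        (\<Sum>k\<le>R. indicat_real (S k N) s *\<^sub>R \<Phi> (2 * k))"
      proof (cases "s \<in> (*) (tt ^ N) ` int_ring")
        case True
        then show ?thesis using expand[OF hK(2)[of s]] by (simp add: S_def hK indicator_def)
      next
        case False
        then show ?thesis by (simp add: S_def)
      qed
    qed
    also have "\<dots> = (\<Sum>k\<le>R. measure ds (S k N) *\<^sub>R \<Phi> (2 * k))"
      using S(1,2) by (intro has_bochner_integral_integral_eq has_bochner_integral_sum
          has_bochner_integral_scaleR_left has_bochner_integral_real_indicator)
        auto
    finally have "(\<integral>s \<in> (*) (tt ^ N) ` int_ring. (\<Phi> \<circ> hK) (X_act x (uu s)) \<partial>ds) =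
      (\<Sum>k\<le>R. measure ds (S k N) *\<^sub>R \<Phi> (2 * k))" .
    then show ?thesis unfolding lambda_den_def by (simp add: q_def scaleR_conv_of_real)
  qed
  have "\<forall>\<^sub>F N in sequentially. \<forall>k\<in>{..R}. measure ds (S k N) = q ^ N * height_mass q k"
    using S(3) by (intro eventually_ball_finite) auto
  then show ?thesis
  proof eventually_elim
    case (elim N)
    have "lambda_den ds x N (\<Phi> \<circ> hK) = inverse (q ^ N) *\<^sub>R (\<Sum>k\<le>R. (q ^ N * height_mass q k) *\<^sub>R \<Phi> (2 * k))"
      unfolding left using elim by (intro arg_cong[of _ _ "(*\<^sub>R) _"] sum.cong) auto
    also have "\<dots> = (\<Sum>k\<le>R. height_mass q k *\<^sub>R \<Phi> (2 * k))"
      using q by (simp add: scaleR_sum_right flip: mult.assoc)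
    finally show ?case by (simp only: right)
  qed
qed

end
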